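(* For each $n$, let $d=d(n)$ with $d\to\infty$ as $n\to\infty$, let $s=s(n)$ with $s=o(\sqrt d)$, and let $\mathcal R_s=\{G_{\boldsymbol w}:\operatorname{maxdeg}(G)\le s\}$. Suppose that the strongly monotone property $\mathcal P$ satisfies $\mathcal P(\varnothing)=0$ and $\mathcal P(C_s)=1$, where $\varnothing$ denotes the graph with no edges and $C_s$ denotes an $s$-clique graph. If for some small $\varepsilon>0$ $$\frac{s\log(d/s^2)}{n}>2+\varepsilon\qquad\text{and}\qquad\frac{s\log(d/(2s))}{n\log\sqrt{2s}}\ge1+\varepsilon,$$ then $$\liminf_{n\to\infty}\ \inf_{\theta\ge0}R_n(\mathcal P,\mathcal R_s,\theta)=1 .$$
   Context: Graphs are finite and simple; $\mathcal G_d$ is the set of graphs with vertex set $[d]=\{1,\dots,d\}$; $\operatorname{maxdeg}(G)$ is the maximum degree. A binary graph property $\mathcal P$ assigns a value in $\{0,1\}$ to graphs; it is evaluated also on graphs with fewer than $d$ vertices and does not depend on the labelling of the vertices. Write $G'\subseteq G$ if $V(G')\subseteq V(G)$ and $E(G')\subseteq E(G)$. $\mathcal P$ is strongly monotone if $\mathcal P(G')\le\mathcal P(G)$ for any two graphs $G'\subseteq G$. $\mathcal G_i=\{G\in\mathcal G_d:\mathcal P(G)=i\}$, $i=0,1$. Model (both signs of interaction allowed): for $\theta\ge0$, a graph $G$ on $[d]$ and $\boldsymbol w\in\{\pm1\}^{\binom d2}$, $\mathbb P_{\theta,G_{\boldsymbol w}}(\boldsymbol X=\boldsymbol x)\propto\exp\big(\theta\sum_{(u,v)\in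 E(G)}w_{uv}x_ux_v\big)$, $\boldsymbol x\in\{\pm1\}^d$; $\mathbb P^{\otimes n}_{\theta,G_{\boldsymbol w}}$ is the law of $n$ i.i.d. observations. Minimax risk: $$R_n(\mathcal P,\mathcal R,\theta)=\inf_\psi\Big[\sup_{\boldsymbol w}\sup_{G\in\mathcal G_0\cap\mathcal R}\mathbb P^{\otimes n}_{\theta,G_{\boldsymbol w}}(\psi=1)+\sup_{\boldsymbol w}\sup_{G\in\mathcal G_1\cap\mathcal R}\mathbb P^{\otimes n}_{\theta,G_{\boldsymbol w}}(\psi=0)\Big],$$ where the infimum is over measurable $\{0,1\}$-valued tests $\psi$ of the $n$ observations, the suprema over $\boldsymbol w$ are over $\{\pm1\}^{\binom d2}$, and $\mathcal R$ restricts the graph $G$ (here: $\operatorname{maxdeg}(G)\le s$). *)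

theory Defs
  imports "HOL-Probability.Probability" "HOL-Library.Landau_Symbols"
begin

section \<open>Finite simple graphs and graph properties\<close>

text \<open>A graph is a pair of a vertex set and a set of edges; an edge is a two-element set of vertices.\<close>

type_synonym ugraph = "nat set \<times> nat set set"

definition all_pairs :: "nat set \<Rightarrow> nat set set" where
  "all_pairs V = {e. e \<subseteq> V \<and> card e = 2}"

definition simple_graph :: "ugraph \<Rightarrow> bool" where
  "simple_graph G \<longleftrightarrow> finite (fst G) \<and> snd G \<subseteq> all_pairs (fst G)"

definition graphs_on :: "nat \<Rightarrow> ugraph set" where
  "graphs_on d = {G. simple_graph G \<and> fst G = {1..d}}"

definition subgraph :: "ugraph \<Rightarrow> ugraph \<Rightarrow> bool" where
  "subgraph G' G \<longleftrightarrow> fst G' \<subseteq> fst G \<and> snd G' \<subseteq> snd G"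

definition degree :: "ugraph \<Rightarrow> nat \<Rightarrow> nat" where
  "degree G v = card {e \<in> snd G. v \<in> e}"

text \<open>Inserting 0 only matters for the graph without vertices, whose maximum degree is set to 0.\<close>

definition maxdeg :: "ugraph \<Rightarrow> nat" where
  "maxdeg G = Max (insert 0 (degree G ` fst G))"

definition edgeless_graph :: "nat \<Rightarrow> ugraph" where
  "edgeless_graph d = ({1..d}, {})"

definition clique_graph :: "nat \<Rightarrow> ugraph" where
  "clique_graph s = ({1..s}, all_pairs {1..s})"

text \<open>
  A binary property takes values in \<^typ>\<open>bool\<close>, with \<^term>\<open>False\<close> for 0 and \<^term>\<open>True\<close> for 1;
  the order on \<^typ>\<open>bool\<close> is then the order of 0 and 1. Only its values at simple graphs matter.
\<close>

definition graph_property :: "(ugraph \<Rightarrow> bool) \<Rightarrow> bool" where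
  "graph_property P \<longleftrightarrow>
     (\<forall>G f. simple_graph G \<and> inj_on f (fst G) \<longrightarrow> P (f ` fst G, (\<lambda>e. f ` e) ` snd G) = P G)"

definition strongly_monotone :: "(ugraph \<Rightarrow> bool) \<Rightarrow> bool" where
  "strongly_monotone P \<longleftrightarrow>
     (\<forall>G' G. simple_graph G' \<and> simple_graph G \<and> subgraph G' G \<longrightarrow> P G' \<le> P G)"

definition property_class :: "(ugraph \<Rightarrow> bool) \<Rightarrow> nat \<Rightarrow> bool \<Rightarrow> ugraph set" where
  "property_class P d b = {G \<in> graphs_on d. P G = b}"

definition maxdeg_le :: "nat \<Rightarrow> ugraph set" where
  "maxdeg_le s = {G. maxdeg G \<le> s}"


section \<open>Signed Ising models\<close>

definition spins :: "nat \<Rightarrow> (nat \<Rightarrow> real) set" where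
  "spins d = {1..d} \<rightarrow>\<^sub>E {-1, 1}"

definition signs :: "nat \<Rightarrow> (nat set \<Rightarrow> real) set" where
  "signs d = all_pairs {1..d} \<rightarrow>\<^sub>E {-1, 1}"

text \<open>For an edge \<open>e = {u, v}\<close> the product over \<open>e\<close> is \<open>x u * x v\<close>.\<close>

definition ising_weight :: "real \<Rightarrow> ugraph \<Rightarrow> (nat set \<Rightarrow> real) \<Rightarrow> (nat \<Rightarrow> real) \<Rightarrow> real" where
  "ising_weight \<theta> G w x = exp (\<theta> * (\<Sum>e\<in>snd G. w e * (\<Prod>u\<in>e. x u)))"

definition ising ::
    "nat \<Rightarrow> real \<Rightarrow> ugraph \<Rightarrow> (nat set \<Rightarrow> real) \<Rightarrow> (nat \<Rightarrow> real) measure" where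
  "ising d \<theta> G w = point_measure (spins d)
     (\<lambda>x. ennreal (ising_weight \<theta> G w x / (\<Sum>y\<in>spins d. ising_weight \<theta> G w y)))"

definition ising_iid ::
    "nat \<Rightarrow> nat \<Rightarrow> real \<Rightarrow> ugraph \<Rightarrow> (nat set \<Rightarrow> real) \<Rightarrow> (nat \<Rightarrow> nat \<Rightarrow> real) measure" where
  "ising_iid n d \<theta> G w = PiM {..<n} (\<lambda>_. ising d \<theta> G w)"


section \<open>Minimax risk\<close>

text \<open>The value \<^term>\<open>True\<close> of a test stands for 1.\<close>

definition tests :: "nat \<Rightarrow> nat \<Rightarrow> ((nat \<Rightarrow> nat \<Rightarrow> real) \<Rightarrow> bool) set" where
  "tests n d = measurable (PiM {..<n} (\<lambda>_. count_space (spins d))) (count_space UNIV)"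

definition worst_error ::
    "nat \<Rightarrow> nat \<Rightarrow> real \<Rightarrow> ugraph set \<Rightarrow> ((nat \<Rightarrow> nat \<Rightarrow> real) \<Rightarrow> bool) \<Rightarrow> bool \<Rightarrow> ennreal" where
  "worst_error n d \<theta> \<G> \<psi> b =
     (SUP w\<in>signs d. SUP G\<in>\<G>.
        emeasure (ising_iid n d \<theta> G w) {X \<in> space (ising_iid n d \<theta> G w). \<psi> X = b})"

text \<open>Risks are extended nonnegative reals, so the supremum over an empty class of graphs is 0.\<close>

definition minimax_risk ::
    "nat \<Rightarrow> nat \<Rightarrow> (ugraph \<Rightarrow> bool) \<Rightarrow> ugraph set \<Rightarrow> real \<Rightarrow> ennreal" where
  "minimax_risk n d P \<R> \<theta> =
     (INF \<psi>\<in>tests n d.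
        worst_error n d \<theta> (property_class P d False \<inter> \<R>) \<psi> True
      + worst_error n d \<theta> (property_class P d True \<inter> \<R>) \<psi> False)"

end

theory Submission
  imports Defs
begin

text \<open>
  The risk is at most 1 because a constant test errs under one hypothesis only. For the lower bound
  it suffices to confuse the edgeless graph, whose spins are independent fair signs, with one
  randomly placed clique. Let \<open>t = 2 m\<close> be the even one of \<open>s\<close> and \<open>s + 1\<close>. A clique on a set \<open>S\<close>
  of \<open>t\<close> vertices has degrees \<open>t - 1 \<le> s\<close> and contains an \<open>s\<close>-clique, so monotonicity and
  invariance under relabelling put it into the alternative (\<open>planted_clique_in_class\<close>).

  Give every edge the sign \<open>-1\<close>. The density of the spins then depends only on the magnetization
  \<open>M = \<Sum>u\<in>S. x u\<close>, through a weight \<open>f(M)\<close> that decreases in \<open>\<bar>M\<bar>\<close>. However large \<open>\<theta>\<close> is, such a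
  model can at most force \<open>M = 0\<close>, an event of probability of order \<open>1 / sqrt t\<close> under fair signs.
  This is why one observation multiplies the likelihood by at most about \<open>sqrt t\<close>, whatever \<open>\<theta>\<close> is,
  whereas strongly attracting spins would reveal the clique within about \<open>ln d\<close> observations.

  Draw \<open>S\<close> uniformly. The chi-square distance between the mixture of the planted laws and the null
  law is \<open>E (I(S, S')^n) - 1\<close>, where \<open>S, S'\<close> are independent and \<open>I\<close> is the inner product of the
  two single-observation densities with respect to the null law. If \<open>S\<close> and \<open>S'\<close> share \<open>k\<close> vertices,
  averaging over the \<open>t - k\<close> spins of \<open>S\<close> outside \<open>S'\<close> replaces \<open>f\<close> by its average over a simple
  random walk of \<open>t - k\<close> steps. That average is largest near the origin (\<open>sym_unimodal_max\<close>), and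
  two more steps of the walk diminish its value there by at most the ratio of the return
  probabilities (\<open>walk_avg_two_more_steps\<close>). Hence \<open>I(S, S')\<close> is at most the ratio of the return
  probabilities at times \<open>t - 2 (k div 2)\<close> and \<open>t\<close>, which is \<open>overlap_bound m (k div 2)\<close>
  (\<open>sum_spin_cube_two_magnetizations\<close>).

  An overlap of \<open>k\<close> vertices has probability at most \<open>(t choose k) (t / d)^k\<close>. For \<open>k \<le> m\<close> the
  bound on \<open>I\<close> is at most \<open>exp (k / t)\<close>, and the condition on \<open>ln (d / s\<^sup>2)\<close> makes the probability
  win. For \<open>k > m\<close> the bound is at most \<open>(2 s) powr (k / (2 s))\<close>, a consequence of the return
  probability at time \<open>t\<close> being at least \<open>1 / sqrt (2 t)\<close>, and the condition on \<open>ln (d / (2 s))\<close>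
  takes over. Both parts are dominated by geometric series whose ratios tend to 0
  (\<open>overlap_moment_le\<close>), so the chi-square distance vanishes uniformly in \<open>\<theta>\<close>.
\<close>


section \<open>Averages over a simple random walk\<close>

definition step_avg :: "(real \<Rightarrow> real) \<Rightarrow> real \<Rightarrow> real" where
  "step_avg f a = (f (a + 1) + f (a - 1)) / 2"

abbreviation walk_avg :: "nat \<Rightarrow> (real \<Rightarrow> real) \<Rightarrow> real \<Rightarrow> real" where
  "walk_avg j \<equiv> step_avg ^^ j"

lemma walk_avg_pos:
  assumes "\<And>a. 0 < f a"
  shows "0 < walk_avg j f a"
  by (induction j arbitrary: a) (auto simp: assms step_avg_def add_pos_pos)

lemma walk_avg_Suc:
  "walk_avg (Suc j) f a = (walk_avg j f (a + 1) + walk_avg j f (a - 1)) / 2"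
  by (simp add: step_avg_def)

lemma walk_avg_binomial:
  "walk_avg j f a = (\<Sum>i\<le>j. real (j choose i) * f (a + 2 * real i - real j)) / 2 ^ j"
proof (induction j arbitrary: a)
  case (Suc j)
  define g where "g = (\<lambda>i. f (a + 2 * real i - real (Suc j)))"
  have up: "walk_avg j f (a + 1) = (\<Sum>i\<le>j. real (j choose i) * g (Suc i)) / 2 ^ j"
    unfolding Suc.IH g_def by (intro arg_cong2[of _ _ _ _ "(/)"] sum.cong) (auto simp: algebra_simps)
  have down: "walk_avg j f (a - 1) = (\<Sum>i\<le>j. real (j choose i) * g i) / 2 ^ j"
    unfolding Suc.IH g_def by (intro arg_cong2[of _ _ _ _ "(/)"] sum.cong) (auto simp: algebra_simps)
  have "(\<Sum>i\<le>Suc j. real (Suc j choose i) * g i)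
      = g 0 + (\<Sum>i\<le>j. real (Suc j choose Suc i) * g (Suc i))"
    by (subst sum.atMost_Suc_shift) simp
  also have "\<dots> = (\<Sum>i\<le>j. real (j choose i) * g (Suc i))
      + (g 0 + (\<Sum>i\<le>j. real (j choose Suc i) * g (Suc i)))"
    by (simp add: distrib_right sum.distrib)
  also have "g 0 + (\<Sum>i\<le>j. real (j choose Suc i) * g (Suc i)) = (\<Sum>i\<le>Suc j. real (j choose i) * g i)"
    by (subst sum.atMost_Suc_shift) simp
  also have "\<dots> = (\<Sum>i\<le>j. real (j choose i) * g i)"
    by simp
  finally have "(\<Sum>i\<le>Suc j. real (Suc j choose i) * g i)
      = (\<Sum>i\<le>j. real (j choose i) * g (Suc i)) + (\<Sum>i\<le>j. real (j choose i) * g i)" .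
  moreover have "walk_avg (Suc j) f a
      = ((\<Sum>i\<le>j. real (j choose i) * g (Suc i)) + (\<Sum>i\<le>j. real (j choose i) * g i)) / 2 ^ Suc j"
    by (simp only: walk_avg_Suc up down) (simp add: field_simps)
  ultimately show ?case
    by (simp only: g_def)
qed simp

text \<open>
  The probability that a simple random walk is at its origin after \<open>2 i - 2\<close> steps, divided by the
  same probability after \<open>2 i\<close> steps.
\<close>

definition return_ratio :: "nat \<Rightarrow> real" where
  "return_ratio i = 2 * real i / (2 * real i - 1)"

lemma return_ratio_ge_1: "1 \<le> i \<Longrightarrow> 1 \<le> return_ratio i"
  by (simp add: return_ratio_def)

text \<open>
  The quotient of the two binomial coefficients is \<open>(2 l + 1) (2 l + 2) / ((l + 1)\<^sup>2 - (l - i)\<^sup>2)\<close>.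
  It is smallest at the centre \<open>i = l\<close>, where equality holds: among all points, the origin is the
  one whose occupation probability suffers most from two further steps.
\<close>

lemma choose_two_more_steps:
  assumes "i \<le> 2 * l"
  shows "4 * real ((2 * l) choose i) \<le> return_ratio (Suc l) * real ((2 * l + 2) choose Suc i)"
proof -
  have s1: "Suc i * ((2*l+2) choose Suc i) = (2*l+2) * ((2*l+1) choose i)"
    using Suc_times_binomial[of i "2*l+1"] by simp
  have s2: "(2*l+1 - i) * ((2*l+1) choose i) = (2*l+1) * ((2*l) choose i)"
    using binomial_absorb_comp[of "2*l+1" i] by simp
  have "((2*l+1-i) * Suc i) * ((2*l+2) choose Suc i) = (2*l+2)*(2*l+1) * ((2*l) choose i)"
    using s1 arg_cong[OF s2, of "(*) (2*l+2)"] by (simp only: mult.assoc mult.left_commute)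
  then have "real ((2*l+1-i) * Suc i * ((2*l+2) choose Suc i)) = real ((2*l+2)*(2*l+1) * ((2*l) choose i))"
    by (rule arg_cong)
  moreover have "real (2*l+1-i) = real (2*l+1) - real i"
    using assms by (simp add: of_nat_diff)
  ultimately have eq: "(real (2*l+1) - real i) * (real i + 1) * real ((2*l+2) choose Suc i)
      = (2 * real l + 2) * (2 * real l + 1) * real ((2*l) choose i)"
    by (simp only: of_nat_mult) (simp add: algebra_simps)
  have sq: "(real (2*l+1) - real i) * (real i + 1) \<le> (real l + 1)^2"
    using zero_le_square[of "real l - real i"] by (simp add: power2_eq_square algebra_simps)
  have "(2 * real l + 2) * (2 * real l + 1) * real ((2*l) choose i)
      \<le> (real l + 1)^2 * real ((2*l+2) choose Suc i)"
    unfolding eq[symmetric] by (intro mult_right_mono sq) auto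
  then have "(real l + 1) * (2 * (2 * real l + 1) * real ((2*l) choose i))
      \<le> (real l + 1) * ((real l + 1) * real ((2*l+2) choose Suc i))"
    by (simp add: power2_eq_square algebra_simps)
  then have "2 * (2 * real l + 1) * real ((2*l) choose i) \<le> (real l + 1) * real ((2*l+2) choose Suc i)"
    by (subst (asm) mult_le_cancel_left_pos) auto
  then show ?thesis
    by (simp add: return_ratio_def field_simps)
qed

text \<open>
  The comparison of the occupation probabilities is pointwise, so a nonnegative \<open>f\<close> of any shape
  inherits it.
\<close>

lemma walk_avg_two_more_steps:
  assumes "\<And>a. 0 \<le> f a"
  shows "walk_avg (2 * l) f 0 \<le> return_ratio (Suc l) * walk_avg (2 * Suc l) f 0"
proof -
  let ?g = "\<lambda>i. f (2 * real i - 2 * real l)"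
  have "4 * (\<Sum>i\<le>2*l. real ((2*l) choose i) * ?g i)
      = (\<Sum>i\<le>2*l. (4 * real ((2*l) choose i)) * ?g i)"
    by (simp add: sum_distrib_left mult.assoc)
  also have "\<dots> \<le> (\<Sum>i\<le>2*l. (return_ratio (Suc l) * real ((2*l+2) choose Suc i)) * ?g i)"
    by (intro sum_mono mult_right_mono choose_two_more_steps assms) auto
  also have "\<dots> = return_ratio (Suc l) * (\<Sum>i\<le>2*l. real ((2*l+2) choose Suc i) * ?g i)"
    by (simp add: sum_distrib_left mult.assoc)
  also have "\<dots> \<le> return_ratio (Suc l)
      * (\<Sum>i\<le>2*l+2. real ((2*l+2) choose i) * f (2 * real i - real (2*l+2)))"
  proof (intro mult_left_mono)
    have "(\<Sum>i\<le>2*l. real ((2*l+2) choose Suc i) * ?g i)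
        = (\<Sum>i\<in>Suc ` {..2*l}. real ((2*l+2) choose i) * f (2 * real i - real (2*l+2)))"
      by (subst sum.reindex) (auto simp: algebra_simps)
    also have "\<dots> \<le> (\<Sum>i\<le>2*l+2. real ((2*l+2) choose i) * f (2 * real i - real (2*l+2)))"
      by (intro sum_mono2) (auto simp: assms)
    finally show "(\<Sum>i\<le>2*l. real ((2*l+2) choose Suc i) * ?g i)
        \<le> (\<Sum>i\<le>2*l+2. real ((2*l+2) choose i) * f (2 * real i - real (2*l+2)))" .
  qed (simp add: return_ratio_def)
  finally show ?thesis
    unfolding walk_avg_binomial by (simp add: field_simps)
qed

text \<open>The quotient of the return probabilities at times \<open>2 (m - h)\<close> and \<open>2 m\<close>.\<close>

definition overlap_bound :: "nat \<Rightarrow> nat \<Rightarrow> real" where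
  "overlap_bound m h = (\<Prod>i\<in>{m - h<..m}. return_ratio i)"

lemma overlap_bound_ge_1: "1 \<le> overlap_bound m h"
  unfolding overlap_bound_def by (intro prod_ge_1 return_ratio_ge_1) auto

lemma walk_avg_more_steps:
  assumes "\<And>a. 0 \<le> f a" and "h \<le> m"
  shows "walk_avg (2 * (m - h)) f 0 \<le> overlap_bound m h * walk_avg (2 * m) f 0"
  using \<open>h \<le> m\<close>
proof (induction h)
  case (Suc h)
  have "m - h = Suc (m - Suc h)" using Suc.prems by simp
  then have ins: "{m - Suc h<..m} = insert (m - h) {m - h<..m}"
    using Suc.prems by auto
  have "walk_avg (2 * (m - Suc h)) f 0 \<le> return_ratio (m - h) * walk_avg (2 * (m - h)) f 0"
    using walk_avg_two_more_steps[where f = f and l = "m - Suc h", OF assms(1)] \<open>m - h = Suc (m - Suc h)\<close> by simp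
  also have "\<dots> \<le> return_ratio (m - h) * (overlap_bound m h * walk_avg (2 * m) f 0)"
    using Suc by (intro mult_left_mono) (auto simp: return_ratio_def)
  also have "\<dots> = overlap_bound m (Suc h) * walk_avg (2 * m) f 0"
    by (simp add: overlap_bound_def ins)
  finally show ?case .
qed (simp add: overlap_bound_def)

text \<open>
  Monotonicity is asked for along integers of equal parity only. This is the form that averaging
  over unit steps preserves: the values on the even and on the odd integers need not be comparable,
  and averaging would destroy monotonicity along the reals.
\<close>

definition sym_unimodal :: "(real \<Rightarrow> real) \<Rightarrow> bool" where
  "sym_unimodal f \<longleftrightarrow> (\<forall>a. f (- a) = f a) \<and> (\<forall>i::nat. f (real i + 2) \<le> f (real i))"

lemma sym_unimodal_step_avg:
  assumes "sym_unimodal f"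
  shows "sym_unimodal (step_avg f)"
  unfolding sym_unimodal_def
proof (intro conjI allI)
  have sym: "f (- a) = f a" and dec: "f (real i + 2) \<le> f (real i)" for a i
    using assms by (auto simp: sym_unimodal_def)
  fix a
  show "step_avg f (- a) = step_avg f a"
    using sym[of "a + 1"] sym[of "a - 1"] by (simp add: step_avg_def)
  fix i :: nat
  have "f (real i + 3) \<le> f (real i - 1)"
  proof (cases i)
    case 0
    then show ?thesis using dec[of 1] sym[of 1] by simp
  next
    case (Suc j)
    then show ?thesis using dec[of j] dec[of "j + 2"] by (simp add: algebra_simps)
  qed
  then show "step_avg f (real i + 2) \<le> step_avg f (real i)"
    by (simp add: step_avg_def algebra_simps)
qed

lemma sym_unimodal_walk_avg: "sym_unimodal f \<Longrightarrow> sym_unimodal (walk_avg j f)"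
  by (induction j) (auto intro: sym_unimodal_step_avg)

lemma sym_unimodal_max:
  assumes "sym_unimodal f"
  shows "f (real_of_int a) \<le> f (if even a then 0 else 1)"
proof -
  have sym: "f (- a) = f a" and dec: "f (real i + 2) \<le> f (real i)" for a i
    using assms by (auto simp: sym_unimodal_def)
  have nat: "f (real i) \<le> f (if even i then 0 else 1)" for i :: nat
  proof (induction i rule: less_induct)
    case (less i)
    show ?case
    proof (cases "i < 2")
      case True
      then have "i = 0 \<or> i = 1" by auto
      then show ?thesis by auto
    next
      case False
      then obtain j where j: "i = j + 2" by (metis add.commute le_Suc_ex not_less)
      show ?thesis
        using less[of j] dec[of j] by (simp add: j algebra_simps split: if_splits)
    qed
  qed
  show ?thesis
  proof (cases "0 \<le> a")
    case True
    then obtain i where "a = int i" by (metis nonneg_eq_int)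
    then show ?thesis using nat[of i] by simp
  next
    case False
    then obtain i where "a = - int i" by (metis int_cases2 of_nat_0_le_iff)
    then show ?thesis using nat[of i] sym[of "real i"] by simp
  qed
qed

text \<open>
  If \<open>k\<close> is odd, the maximum over the odd integers is attained at 1, and the value there is the
  average after one more step at 0. So the rounding in \<open>k div 2\<close> favours the bound.
\<close>

lemma walk_avg_le_overlap_bound:
  assumes "sym_unimodal f" and "\<And>a. 0 \<le> f a" and "k \<le> 2 * m" and "even a \<longleftrightarrow> even k"
  shows "walk_avg (2 * m - k) f (real_of_int a) \<le> overlap_bound m (k div 2) * walk_avg (2 * m) f 0"
proof (cases "even k")
  case True
  then have "2 * m - k = 2 * (m - k div 2)" by (auto elim!: evenE)
  then show ?thesis
    using sym_unimodal_max[OF sym_unimodal_walk_avg[OF assms(1)], of "2 * m - k" a]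
      walk_avg_more_steps[where f = f and h = "k div 2" and m = m, OF assms(2)] assms(3,4) True by auto
next
  case False
  then obtain h where h: "k = 2 * h + 1" by (auto elim!: oddE)
  then have "2 * (m - k div 2) = Suc (2 * m - k)" using assms(3) by auto
  moreover have "walk_avg (Suc j) f 0 = walk_avg j f 1" for j
    using sym_unimodal_walk_avg[OF assms(1), of j] by (simp add: sym_unimodal_def step_avg_def)
  ultimately show ?thesis
    using sym_unimodal_max[OF sym_unimodal_walk_avg[OF assms(1)], of "2 * m - k" a]
      walk_avg_more_steps[where f = f and h = "k div 2" and m = m, OF assms(2)] assms(3,4) False h by simp
qed


section \<open>Magnetizations of overlapping sets of spins\<close>

abbreviation spin_cube :: "nat set \<Rightarrow> (nat \<Rightarrow> real) set" where
  "spin_cube V \<equiv> V \<rightarrow>\<^sub>E {-1, 1}"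

lemma sum_spin_cube_insert:
  fixes g :: "(nat \<Rightarrow> real) \<Rightarrow> real"
  assumes "v \<notin> V"
  shows "(\<Sum>x\<in>spin_cube (insert v V). g x) = (\<Sum>x\<in>spin_cube V. g (x(v := 1)) + g (x(v := - 1)))"
proof -
  have "(\<Sum>x\<in>spin_cube (insert v V). g x)
      = (\<Sum>(y, x)\<in>{- 1, 1} \<times> spin_cube V. g (x(v := y)))"
    unfolding PiE_insert_eq
    by (subst sum.reindex[OF inj_combinator[OF assms]]) (auto simp: case_prod_unfold intro!: sum.cong)
  also have "\<dots> = (\<Sum>y\<in>{- 1, 1}. \<Sum>x\<in>spin_cube V. g (x(v := y)))"
    by (rule sum.cartesian_product[symmetric])
  finally show ?thesis
    by (simp add: sum.distrib)
qed

text \<open>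
  Summing out the spins in \<open>A\<close> one at a time turns their share of the magnetization into the steps of
  a random walk started at the magnetization of \<open>B\<close>. The factor \<open>h\<close> collects what does not involve
  these spins.
\<close>

lemma sum_spin_cube_walk_avg:
  fixes h :: "(nat \<Rightarrow> real) \<Rightarrow> real"
  assumes "finite A" and "finite B" and "A \<inter> V = {}" and "B \<subseteq> V"
    and "\<And>u x c. u \<in> A \<Longrightarrow> h (x(u := c)) = h x"
  shows "(\<Sum>x\<in>spin_cube (A \<union> V). f (\<Sum>u\<in>A \<union> B. x u) * h x)
       = 2 ^ card A * (\<Sum>x\<in>spin_cube V. walk_avg (card A) f (\<Sum>u\<in>B. x u) * h x)"
  using assms
proof (induction A arbitrary: B V rule: finite_induct)
  case (insert v A)
  have v: "v \<notin> V" "v \<notin> B" using insert.prems by auto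
  have "(\<Sum>x\<in>spin_cube (insert v A \<union> V). f (\<Sum>u\<in>insert v A \<union> B. x u) * h x)
      = (\<Sum>x\<in>spin_cube (A \<union> insert v V). f (\<Sum>u\<in>A \<union> insert v B. x u) * h x)"
    by simp
  also have "\<dots> = 2 ^ card A
      * (\<Sum>x\<in>spin_cube (insert v V). walk_avg (card A) f (\<Sum>u\<in>insert v B. x u) * h x)"
    using insert.prems insert.hyps by (intro insert.IH) auto
  also have "(\<Sum>x\<in>spin_cube (insert v V). walk_avg (card A) f (\<Sum>u\<in>insert v B. x u) * h x)
      = (\<Sum>x\<in>spin_cube V. 2 * (walk_avg (Suc (card A)) f (\<Sum>u\<in>B. x u) * h x))"
  proof (subst sum_spin_cube_insert[OF v(1)], intro sum.cong refl)
    fix x :: "nat \<Rightarrow> real"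
    have "(\<Sum>u\<in>insert v B. (x(v := c)) u) = c + (\<Sum>u\<in>B. x u)" for c
      using v insert.prems by (subst sum.insert) (auto intro!: sum.cong)
    moreover have "h (x(v := c)) = h x" for c
      by (rule insert.prems(4)) simp
    ultimately show "walk_avg (card A) f (\<Sum>u\<in>insert v B. (x(v := 1)) u) * h (x(v := 1))
        + walk_avg (card A) f (\<Sum>u\<in>insert v B. (x(v := - 1)) u) * h (x(v := - 1))
        = 2 * (walk_avg (Suc (card A)) f (\<Sum>u\<in>B. x u) * h x)"
      by (simp only: walk_avg_Suc) (simp add: algebra_simps)
  qed
  also have "\<dots> = 2 * (\<Sum>x\<in>spin_cube V. walk_avg (Suc (card A)) f (\<Sum>u\<in>B. x u) * h x)"
    by (simp only: sum_distrib_left)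
  finally show ?case
    using insert.hyps by simp
qed simp

lemma card_spin_cube: "finite V \<Longrightarrow> card (spin_cube V) = 2 ^ card V"
  by (simp add: card_PiE numeral_2_eq_2)

lemma finite_spin_cube: "finite V \<Longrightarrow> finite (spin_cube V)"
  by (simp add: finite_PiE)

lemma sum_spin_cube_magnetization:
  assumes "finite V" and "S \<subseteq> V"
  shows "(\<Sum>x\<in>spin_cube V. f (\<Sum>u\<in>S. x u)) = 2 ^ card V * walk_avg (card S) f 0"
proof -
  have fin: "finite S" using assms finite_subset by auto
  have "(\<Sum>x\<in>spin_cube (S \<union> (V - S)). f (\<Sum>u\<in>S \<union> {}. x u) * 1)
      = 2 ^ card S * (\<Sum>x\<in>spin_cube (V - S). walk_avg (card S) f (\<Sum>u\<in>{}. x u) * 1)"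
    using fin by (intro sum_spin_cube_walk_avg) auto
  moreover have "S \<union> (V - S) = V" using assms by auto
  moreover have "card V = card S + card (V - S)"
    using assms fin by (metis card_Diff_subset card_mono le_add_diff_inverse)
  ultimately show ?thesis
    using assms by (simp add: card_spin_cube power_add)
qed

lemma magnetization_parity:
  assumes "finite S" and "S \<subseteq> V" and "x \<in> spin_cube V"
  obtains a :: int where "(\<Sum>u\<in>S. x u) = real_of_int a" and "even a \<longleftrightarrow> even (card S)"
proof -
  have "\<exists>a::int. (\<Sum>u\<in>S. x u) = real_of_int a \<and> (even a \<longleftrightarrow> even (card S))"
    using assms(1,2)
  proof (induction S rule: finite_induct)
    case (insert v S)
    then obtain a :: int where a: "(\<Sum>u\<in>S. x u) = real_of_int a" "even a \<longleftrightarrow> even (card S)"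
      by auto
    have "x v = - 1 \<or> x v = 1" using assms(3) insert.prems by auto
    then have "(\<Sum>u\<in>insert v S. x u) = real_of_int (a - 1)
        \<or> (\<Sum>u\<in>insert v S. x u) = real_of_int (a + 1)"
      using a insert.hyps by auto
    moreover have "even (a - 1) \<longleftrightarrow> even (card (insert v S))" "even (a + 1) \<longleftrightarrow> even (card (insert v S))"
      using a insert.hyps by auto
    ultimately show ?case by blast
  qed auto
  then show ?thesis using that by blast
qed

text \<open>
  The spins in \<open>S - S'\<close> occur in the first factor only. Once they are summed out, the first factor
  is a random walk average evaluated at the magnetization of \<open>S \<inter> S'\<close>, an integer with the parity
  of the number of steps, and is bounded uniformly. What is left is a sum over a single magnetization.
\<close>

lemma sum_spin_cube_two_magnetizations:
  assumes "finite V" and "S \<subseteq> V" and "S' \<subseteq> V" and "card S = 2 * m" and "card S' = 2 * m"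
    and "sym_unimodal f" and nonneg: "\<And>a. 0 \<le> f a"
  shows "(\<Sum>x\<in>spin_cube V. f (\<Sum>u\<in>S. x u) * f (\<Sum>u\<in>S'. x u))
       \<le> overlap_bound m (card (S \<inter> S') div 2) * (2 ^ card V * (walk_avg (2 * m) f 0)\<^sup>2)"
proof -
  define A B W where "A = S - S'" and "B = S \<inter> S'" and "W = V - A"
  define F where "F = walk_avg (2 * m) f 0"
  define b where "b = overlap_bound m (card B div 2)"
  have fin: "finite S" "finite S'" "finite A" "finite B" "finite W"
    using assms(1) finite_subset[OF assms(2)] finite_subset[OF assms(3)] by (auto simp: A_def B_def W_def)
  have AB: "A \<union> B = S" "A \<union> W = V" "A \<inter> W = {}" "B \<subseteq> W" "S' \<subseteq> W"
    using assms by (auto simp: A_def B_def W_def)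
  have "card S = card A + card B"
    using card_Un_disjoint[of A B] fin AB(1) by (auto simp: A_def B_def)
  then have cA: "card A = 2 * m - card B" and cB: "card B \<le> 2 * m"
    using assms by auto
  have cV: "card V = card A + card W"
    using fin AB by (metis card_Un_disjoint)
  \<comment> \<open>\<open>card A\<close> and \<open>card B\<close> add up to \<open>2 m\<close> and so have the same parity.\<close>
  have bound: "walk_avg (card A) f (\<Sum>u\<in>B. x u) \<le> b * F" if x: "x \<in> spin_cube W" for x
  proof -
    obtain a :: int where "(\<Sum>u\<in>B. x u) = real_of_int a" "even a \<longleftrightarrow> even (card B)"
      using magnetization_parity[OF fin(4) AB(4) x] by blast
    then show ?thesis
      unfolding cA b_def F_def
      using walk_avg_le_overlap_bound[where f = f, OF assms(6) nonneg cB] by simp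
  qed
  have "(\<Sum>x\<in>spin_cube V. f (\<Sum>u\<in>S. x u) * f (\<Sum>u\<in>S'. x u))
      = (\<Sum>x\<in>spin_cube (A \<union> W). f (\<Sum>u\<in>A \<union> B. x u) * f (\<Sum>u\<in>S'. x u))"
    by (simp add: AB)
  also have "\<dots> = 2 ^ card A
      * (\<Sum>x\<in>spin_cube W. walk_avg (card A) f (\<Sum>u\<in>B. x u) * f (\<Sum>u\<in>S'. x u))"
  proof (rule sum_spin_cube_walk_avg)
    fix u x and c :: real
    assume "u \<in> A"
    then show "f (\<Sum>i\<in>S'. (x(u := c)) i) = f (\<Sum>i\<in>S'. x i)"
      by (intro arg_cong[of _ _ f] sum.cong) (auto simp: A_def)
  qed (use fin AB in auto)
  also have "\<dots> \<le> 2 ^ card A * (\<Sum>x\<in>spin_cube W. (b * F) * f (\<Sum>u\<in>S'. x u))"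
    by (intro mult_left_mono sum_mono mult_right_mono bound nonneg) auto
  also have "\<dots> = 2 ^ card A * ((b * F) * (2 ^ card W * F))"
    using sum_spin_cube_magnetization[OF fin(5) AB(5), of f] assms(5)
    by (simp only: sum_distrib_left[symmetric] F_def)
  also have "\<dots> = b * (2 ^ card V * F\<^sup>2)"
    by (simp add: cV power_add power2_eq_square)
  finally show ?thesis
    by (simp add: b_def B_def F_def)
qed

section \<open>Overlaps of random subsets\<close>

lemma card_supersets_of_size:
  assumes "finite V" and "K \<subseteq> V" and "card K \<le> t"
  shows "card {S. S \<subseteq> V \<and> card S = t \<and> K \<subseteq> S} = (card V - card K) choose (t - card K)"
proof -
  have finK: "finite K" using assms finite_subset by auto
  have "bij_betw (\<lambda>S. S \<union> K) {R. R \<subseteq> V - K \<and> card R = t - card K}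
      {S. S \<subseteq> V \<and> card S = t \<and> K \<subseteq> S}"
  proof (rule bij_betw_byWitness[where f' = "\<lambda>S. S - K"])
    show "(\<lambda>S. S \<union> K) ` {R. R \<subseteq> V - K \<and> card R = t - card K} \<subseteq> {S. S \<subseteq> V \<and> card S = t \<and> K \<subseteq> S}"
    proof (intro image_subsetI)
      fix R assume R: "R \<in> {R. R \<subseteq> V - K \<and> card R = t - card K}"
      then have "finite R" "R \<inter> K = {}" using assms finite_subset by auto
      then have "card (R \<union> K) = card R + card K" using finK by (simp add: card_Un_disjoint)
      then show "R \<union> K \<in> {S. S \<subseteq> V \<and> card S = t \<and> K \<subseteq> S}" using R assms by auto
    qed
    show "(\<lambda>S. S - K) ` {S. S \<subseteq> V \<and> card S = t \<and> K \<subseteq> S} \<subseteq> {R. R \<subseteq> V - K \<and> card R = t - card K}"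
      using finK by (auto simp: card_Diff_subset)
  qed auto
  then have "card {S. S \<subseteq> V \<and> card S = t \<and> K \<subseteq> S} = card {R. R \<subseteq> V - K \<and> card R = t - card K}"
    by (simp add: bij_betw_same_card)
  also have "\<dots> = card (V - K) choose (t - card K)"
    using assms by (intro n_subsets) auto
  finally show ?thesis
    using assms finK by (simp add: card_Diff_subset)
qed

lemma choose_drop_le:
  assumes "k \<le> t" and "t \<le> d"
  shows "real ((d - k) choose (t - k)) \<le> (real t / real d) ^ k * real (d choose t)"
  using assms(1)
proof (induction k)
  case (Suc k)
  have eq: "Suc (t - Suc k) = t - k" "Suc (d - Suc k) = d - k" using Suc.prems assms by auto
  have "(t - k) * ((d - k) choose (t - k)) = (d - k) * ((d - Suc k) choose (t - Suc k))"
    using Suc_times_binomial[of "t - Suc k" "d - Suc k"] eq by simp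
  then have id: "(real t - real k) * real ((d - k) choose (t - k))
      = (real d - real k) * real ((d - Suc k) choose (t - Suc k))"
    using Suc.prems assms by (metis Suc_leD le_trans of_nat_diff of_nat_mult)
  have pos: "real d - real k > 0" using Suc.prems assms by auto
  have "real ((d - Suc k) choose (t - Suc k))
      = (real t - real k) / (real d - real k) * real ((d - k) choose (t - k))"
    using id pos by (simp add: field_simps)
  also have "\<dots> \<le> real t / real d * real ((d - k) choose (t - k))"
  proof (rule mult_right_mono)
    have "real k * real t \<le> real k * real d"
      using assms by (intro mult_left_mono) auto
    then show "(real t - real k) / (real d - real k) \<le> real t / real d"
      using pos by (simp add: divide_simps algebra_simps)
  qed auto
  also have "\<dots> \<le> real t / real d * ((real t / real d) ^ k * real (d choose t))"
    using Suc by (intro mult_left_mono) auto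
  finally show ?case by (simp add: mult.assoc)
qed simp

lemma sum_Pow_card:
  fixes g :: "nat \<Rightarrow> real"
  assumes "finite S"
  shows "(\<Sum>K\<in>Pow S. g (card K)) = (\<Sum>k\<le>card S. real (card S choose k) * g k)"
proof -
  have "(\<Sum>K\<in>Pow S. g (card K)) = (\<Sum>k\<le>card S. \<Sum>K | K \<in> Pow S \<and> card K = k. g (card K))"
    using assms by (intro sum.group[symmetric]) (auto intro: card_mono)
  also have "\<dots> = (\<Sum>k\<le>card S. real (card S choose k) * g k)"
  proof (intro sum.cong refl)
    fix k
    have "(\<Sum>K | K \<in> Pow S \<and> card K = k. g (card K)) = real (card {K. K \<in> Pow S \<and> card K = k}) * g k"
      by simp
    then show "(\<Sum>K | K \<in> Pow S \<and> card K = k. g (card K)) = real (card S choose k) * g k"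
      using n_subsets[OF assms, of k] by simp
  qed
  finally show ?thesis .
qed

text \<open>
  For a uniformly random \<open>S\<close>, the event \<open>S \<inter> S' = K\<close> is contained in \<open>K \<subseteq> S\<close>, whose probability is
  at most \<open>(t / card V) ^ card K\<close>; and \<open>S'\<close> has \<open>t choose k\<close> subsets \<open>K\<close> with \<open>k\<close> elements.
\<close>

lemma sum_overlap_le:
  fixes g :: "nat \<Rightarrow> real"
  assumes "finite V" and "S' \<subseteq> V" and "card S' = t" and nonneg: "\<And>k. 0 \<le> g k"
  shows "(\<Sum>S | S \<subseteq> V \<and> card S = t. g (card (S \<inter> S')))
       \<le> real (card V choose t) * (\<Sum>k\<le>t. real (t choose k) * (real t / real (card V)) ^ k * g k)"
proof -
  let ?T = "{S. S \<subseteq> V \<and> card S = t}"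
  have finT: "finite ?T" using assms by (auto intro: finite_subset[of _ "Pow V"])
  have finS: "finite S'" using assms finite_subset by auto
  have tV: "t \<le> card V" using assms card_mono by auto
  have "(\<Sum>S\<in>?T. g (card (S \<inter> S'))) \<le> (\<Sum>S\<in>?T. \<Sum>K\<in>Pow S'. if K \<subseteq> S then g (card K) else 0)"
  proof (intro sum_mono)
    fix S
    have "(if S \<inter> S' \<subseteq> S then g (card (S \<inter> S')) else 0) \<le> (\<Sum>K\<in>Pow S'. if K \<subseteq> S then g (card K) else 0)"
      using finS nonneg by (intro member_le_sum) auto
    then show "g (card (S \<inter> S')) \<le> (\<Sum>K\<in>Pow S'. if K \<subseteq> S then g (card K) else 0)"
      by simp
  qed
  also have "\<dots> = (\<Sum>K\<in>Pow S'. \<Sum>S\<in>?T. if K \<subseteq> S then g (card K) else 0)"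
    by (rule sum.swap)
  also have "\<dots> = (\<Sum>K\<in>Pow S'. real ((card V - card K) choose (t - card K)) * g (card K))"
  proof (intro sum.cong refl)
    fix K assume K: "K \<in> Pow S'"
    have "{S \<in> ?T. K \<subseteq> S} = {S. S \<subseteq> V \<and> card S = t \<and> K \<subseteq> S}"
      by auto
    then have "(\<Sum>S\<in>?T. if K \<subseteq> S then g (card K) else 0)
        = real (card {S. S \<subseteq> V \<and> card S = t \<and> K \<subseteq> S}) * g (card K)"
      using sum.inter_filter[OF finT, of "\<lambda>_. g (card K)" "\<lambda>S. K \<subseteq> S"] by simp
    also have "\<dots> = real ((card V - card K) choose (t - card K)) * g (card K)"
      using K assms finS card_mono[OF finS, of K] by (subst card_supersets_of_size) auto
    finally show "(\<Sum>S\<in>?T. if K \<subseteq> S then g (card K) else 0)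
        = real ((card V - card K) choose (t - card K)) * g (card K)" .
  qed
  also have "\<dots> = (\<Sum>k\<le>t. real (t choose k) * (real ((card V - k) choose (t - k)) * g k))"
    using sum_Pow_card[OF finS, of "\<lambda>k. real ((card V - k) choose (t - k)) * g k"] assms by simp
  also have "\<dots> \<le> (\<Sum>k\<le>t. real (t choose k)
      * ((real t / real (card V)) ^ k * real (card V choose t) * g k))"
    using tV by (intro sum_mono mult_left_mono mult_right_mono choose_drop_le nonneg) auto
  also have "\<dots> = real (card V choose t)
      * (\<Sum>k\<le>t. real (t choose k) * (real t / real (card V)) ^ k * g k)"
    by (simp add: sum_distrib_left mult_ac)
  finally show ?thesis .
qed

section \<open>Testing errors and the chi-square distance\<close>

text \<open>
  The sum of the errors falls short of 1 by at most the \<open>L\<^sup>1\<close> distance, which the Cauchy-Schwarz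
  inequality bounds by the root of the chi-square distance.
\<close>

lemma testing_error_ge_chi_square:
  fixes q r :: "'a \<Rightarrow> real"
  assumes "finite \<Omega>" and "A \<subseteq> \<Omega>" and q: "\<And>x. x \<in> \<Omega> \<Longrightarrow> 0 < q x"
    and "sum q \<Omega> = 1" and "sum r \<Omega> = 1"
  shows "1 - sqrt ((\<Sum>x\<in>\<Omega>. (r x)\<^sup>2 / q x) - 1) \<le> sum q A + sum r (\<Omega> - A)"
proof -
  have "(\<Sum>x\<in>\<Omega>. \<bar>q x - r x\<bar>)\<^sup>2 = (\<Sum>x\<in>\<Omega>. sqrt (q x) * (\<bar>q x - r x\<bar> / sqrt (q x)))\<^sup>2"
    using q by (intro arg_cong[of _ _ "\<lambda>a. a\<^sup>2"] sum.cong) (auto simp: less_le)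
  also have "\<dots> \<le> (\<Sum>x\<in>\<Omega>. (sqrt (q x))\<^sup>2) * (\<Sum>x\<in>\<Omega>. (\<bar>q x - r x\<bar> / sqrt (q x))\<^sup>2)"
    by (rule Cauchy_Schwarz_ineq_sum)
  also have "(\<Sum>x\<in>\<Omega>. (sqrt (q x))\<^sup>2) = sum q \<Omega>"
    using q by (intro sum.cong) (auto simp: less_imp_le)
  also have "(\<Sum>x\<in>\<Omega>. (\<bar>q x - r x\<bar> / sqrt (q x))\<^sup>2) = (\<Sum>x\<in>\<Omega>. q x - 2 * r x + (r x)\<^sup>2 / q x)"
  proof (intro sum.cong refl)
    fix x assume "x \<in> \<Omega>"
    then have "0 < q x" by (rule q)
    then show "(\<bar>q x - r x\<bar> / sqrt (q x))\<^sup>2 = q x - 2 * r x + (r x)\<^sup>2 / q x"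
      by (simp add: power_divide less_imp_le) (simp add: field_simps power2_eq_square)
  qed
  also have "\<dots> = sum q \<Omega> - 2 * sum r \<Omega> + (\<Sum>x\<in>\<Omega>. (r x)\<^sup>2 / q x)"
    by (simp add: sum.distrib sum_subtractf sum_distrib_left)
  finally have "(\<Sum>x\<in>\<Omega>. \<bar>q x - r x\<bar>)\<^sup>2 \<le> (\<Sum>x\<in>\<Omega>. (r x)\<^sup>2 / q x) - 1"
    using assms by simp
  then have tv: "(\<Sum>x\<in>\<Omega>. \<bar>q x - r x\<bar>) \<le> sqrt ((\<Sum>x\<in>\<Omega>. (r x)\<^sup>2 / q x) - 1)"
    by (rule real_le_rsqrt)
  have "1 = sum q A + sum q (\<Omega> - A)"
    using assms sum.subset_diff[of A \<Omega> q] by simp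
  moreover have "sum q (\<Omega> - A) - sum r (\<Omega> - A) \<le> (\<Sum>x\<in>\<Omega> - A. \<bar>q x - r x\<bar>)"
    by (simp add: sum_subtractf[symmetric] sum_mono)
  moreover have "\<dots> \<le> (\<Sum>x\<in>\<Omega>. \<bar>q x - r x\<bar>)"
    using assms by (intro sum_mono2) auto
  ultimately show ?thesis using tv by linarith
qed


section \<open>Cliques of repelling spins\<close>

definition planted_clique :: "nat \<Rightarrow> nat set \<Rightarrow> ugraph" where
  "planted_clique d S = ({1..d}, all_pairs S)"

definition repulsive_signs :: "nat \<Rightarrow> nat set \<Rightarrow> real" where
  "repulsive_signs d = (\<lambda>e\<in>all_pairs {1..d}. - 1)"

lemma repulsive_signs_in_signs: "repulsive_signs d \<in> signs d"
  by (simp add: repulsive_signs_def signs_def)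

lemma finite_all_pairs: "finite V \<Longrightarrow> finite (all_pairs V)"
  unfolding all_pairs_def by (rule finite_subset[of _ "Pow V"]) auto

lemma all_pairs_insert:
  assumes "finite S" and "v \<notin> S"
  shows "all_pairs (insert v S) = all_pairs S \<union> (\<lambda>u. {v, u}) ` S"
proof (intro equalityI subsetI)
  fix e assume e: "e \<in> all_pairs (insert v S)"
  then obtain a b where ab: "e = {a, b}" "a \<noteq> b"
    by (auto simp: all_pairs_def card_2_iff)
  show "e \<in> all_pairs S \<union> (\<lambda>u. {v, u}) ` S"
    using e ab by (auto simp: all_pairs_def insert_commute)
next
  fix e assume "e \<in> all_pairs S \<union> (\<lambda>u. {v, u}) ` S"
  then show "e \<in> all_pairs (insert v S)"
    using assms by (auto simp: all_pairs_def card_2_iff)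
qed

lemma sum_all_pairs_spins:
  fixes x :: "nat \<Rightarrow> real"
  assumes "finite S" and "\<And>u. u \<in> S \<Longrightarrow> (x u)\<^sup>2 = 1"
  shows "(\<Sum>e\<in>all_pairs S. \<Prod>u\<in>e. x u) = ((\<Sum>u\<in>S. x u)\<^sup>2 - real (card S)) / 2"
  using assms
proof (induction S rule: finite_induct)
  case empty
  have "all_pairs {} = {}" by (auto simp: all_pairs_def)
  then show ?case by simp
next
  case (insert v S)
  have disj: "all_pairs S \<inter> (\<lambda>u. {v, u}) ` S = {}"
    using insert.hyps by (auto simp: all_pairs_def)
  have inj: "inj_on (\<lambda>u. {v, u}) S"
    using insert.hyps by (auto simp: inj_on_def doubleton_eq_iff)
  have "prod x {v, u} = x v * x u" if "u \<in> S" for u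
    using that insert.hyps(2) by (subst prod.insert) auto
  then have "(\<Sum>e\<in>(\<lambda>u. {v, u}) ` S. \<Prod>u\<in>e. x u) = (\<Sum>u\<in>S. x v * x u)"
    by (subst sum.reindex[OF inj]) (simp add: o_def)
  then have "(\<Sum>e\<in>all_pairs (insert v S). \<Prod>u\<in>e. x u)
      = ((\<Sum>u\<in>S. x u)\<^sup>2 - real (card S)) / 2 + x v * (\<Sum>u\<in>S. x u)"
    using insert disj finite_all_pairs[of S]
    by (simp add: all_pairs_insert sum.union_disjoint sum_distrib_left)
  then show ?case
    using insert by (simp add: power2_eq_square field_simps)
qed

text \<open>
  The weight of a clique on \<open>t\<close> vertices with magnetization \<open>a\<close>, since the products over pairs of
  distinct spins sum to \<open>(a\<^sup>2 - t) / 2\<close>.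
\<close>

definition repulsion :: "real \<Rightarrow> nat \<Rightarrow> real \<Rightarrow> real" where
  "repulsion \<theta> t a = exp (- \<theta> * (a\<^sup>2 - real t) / 2)"

lemma repulsion_pos: "0 < repulsion \<theta> t a"
  by (simp add: repulsion_def)

lemma sym_unimodal_repulsion:
  assumes "0 \<le> \<theta>"
  shows "sym_unimodal (repulsion \<theta> t)"
  unfolding sym_unimodal_def
proof (intro conjI allI)
  fix i :: nat
  have "(real i)\<^sup>2 \<le> (real i + 2)\<^sup>2"
    by (rule power_mono) auto
  then have "\<theta> * (real i)\<^sup>2 \<le> \<theta> * (real i + 2)\<^sup>2"
    using assms by (rule mult_left_mono)
  then show "repulsion \<theta> t (real i + 2) \<le> repulsion \<theta> t (real i)"
    by (simp add: repulsion_def right_diff_distrib)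
qed (simp add: repulsion_def)

lemma spins_eq_spin_cube: "spins d = spin_cube {1..d}"
  by (simp add: spins_def)

lemma spin_square: "x \<in> spin_cube V \<Longrightarrow> u \<in> V \<Longrightarrow> (x u)\<^sup>2 = 1"
  by (auto simp: PiE_iff power2_eq_square)

lemma ising_weight_planted_clique:
  assumes "S \<subseteq> {1..d}" and "x \<in> spins d"
  shows "ising_weight \<theta> (planted_clique d S) (repulsive_signs d) x
       = repulsion \<theta> (card S) (\<Sum>u\<in>S. x u)"
proof -
  have fin: "finite S" using assms(1) finite_subset by auto
  have sub: "all_pairs S \<subseteq> all_pairs {1..d}"
    using assms(1) by (auto simp: all_pairs_def)
  have sign: "repulsive_signs d e = - 1" if "e \<in> all_pairs S" for e
    using subsetD[OF sub that] by (simp only: repulsive_signs_def restrict_apply if_True)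
  have "(\<Sum>e\<in>all_pairs S. repulsive_signs d e * (\<Prod>u\<in>e. x u)) = - (\<Sum>e\<in>all_pairs S. \<Prod>u\<in>e. x u)"
    unfolding sum_negf[symmetric] by (intro sum.cong) (simp_all add: sign)
  also have "(\<Sum>e\<in>all_pairs S. \<Prod>u\<in>e. x u) = ((\<Sum>u\<in>S. x u)\<^sup>2 - real (card S)) / 2"
    using assms spin_square[of x "{1..d}"] by (intro sum_all_pairs_spins[OF fin]) (auto simp: spins_eq_spin_cube)
  finally show ?thesis
    by (simp add: ising_weight_def planted_clique_def repulsion_def)
qed

lemma ising_weight_edgeless: "ising_weight \<theta> (edgeless_graph d) w x = 1"
  by (simp add: ising_weight_def edgeless_graph_def)

section \<open>Laws of the observations as finite sums\<close>

lemma sum_PiE_prod_eq_1: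
  fixes g :: "'a \<Rightarrow> real" and n :: nat
  assumes "finite \<Omega>" and "sum g \<Omega> = 1"
  shows "(\<Sum>X\<in>(\<Pi>\<^sub>E i\<in>{..<n}. \<Omega>). \<Prod>i<n. g (X i)) = 1"
  using assms by (subst prod_sum_PiE[symmetric]) auto

lemma emeasure_PiM_point_measure:
  assumes fin: "finite \<Omega>" "finite I" and p: "\<And>x. x \<in> \<Omega> \<Longrightarrow> 0 \<le> p x" "sum p \<Omega> = 1"
    and A: "A \<subseteq> (\<Pi>\<^sub>E i\<in>I. \<Omega>)"
  shows "emeasure (PiM I (\<lambda>_. point_measure \<Omega> (\<lambda>x. ennreal (p x)))) A
       = ennreal (\<Sum>X\<in>A. \<Prod>i\<in>I. p (X i))"
proof -
  define M where "M = point_measure \<Omega> (\<lambda>x. ennreal (p x))"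
  interpret prob_space M
    unfolding M_def using p by (intro prob_space_point_measure fin) auto
  interpret product_sigma_finite "\<lambda>_. M"
    by unfold_locales
  have finA: "finite A"
    using A fin by (meson finite_PiE finite_subset)
  have single: "{X} = (\<Pi>\<^sub>E i\<in>I. {X i})" if "X \<in> A" for X
    using that A by (subst PiE_singleton) (auto simp: PiE_iff)
  have meas: "{X i} \<in> sets M" if "X \<in> A" "i \<in> I" for X i
    using that A by (auto simp: M_def sets_point_measure)
  have X: "{X} \<in> sets (PiM I (\<lambda>_. M))" "emeasure (PiM I (\<lambda>_. M)) {X} = ennreal (\<Prod>i\<in>I. p (X i))"
    if "X \<in> A" for X
  proof -
    show "{X} \<in> sets (PiM I (\<lambda>_. M))"
      unfolding single[OF that] using that meas by (intro sets_PiM_I_finite fin) auto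
    have "emeasure (PiM I (\<lambda>_. M)) {X} = (\<Prod>i\<in>I. emeasure M {X i})"
      unfolding single[OF that] using that meas by (intro emeasure_PiM fin) auto
    also have "\<dots> = (\<Prod>i\<in>I. ennreal (p (X i)))"
    proof (intro prod.cong refl)
      fix i assume "i \<in> I"
      then have "X i \<in> \<Omega>" using that A by (auto simp: PiE_iff)
      then show "emeasure M {X i} = ennreal (p (X i))"
        unfolding M_def using fin(1) by (subst emeasure_point_measure_finite) auto
    qed
    also have "\<dots> = ennreal (\<Prod>i\<in>I. p (X i))"
      using that A p by (intro prod_ennreal) auto
    finally show "emeasure (PiM I (\<lambda>_. M)) {X} = ennreal (\<Prod>i\<in>I. p (X i))" .
  qed
  have "emeasure (PiM I (\<lambda>_. M)) A = (\<Sum>X\<in>A. ennreal (\<Prod>i\<in>I. p (X i)))"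
    using emeasure_eq_sum_singleton[OF finA X(1)] X(2) by simp
  also have "\<dots> = ennreal (\<Sum>X\<in>A. \<Prod>i\<in>I. p (X i))"
    using A p by (intro sum_ennreal prod_nonneg) auto
  finally show ?thesis by (simp add: M_def)
qed

lemma sum_ising_density:
  assumes p: "\<And>x. x \<in> spins d \<Longrightarrow> p x = ising_weight \<theta> G w x / (\<Sum>y\<in>spins d. ising_weight \<theta> G w y)"
  shows "sum p (spins d) = 1"
proof -
  have "finite (spins d)" "card (spins d) \<noteq> 0"
    by (simp_all add: spins_eq_spin_cube finite_spin_cube card_spin_cube)
  then have "0 < (\<Sum>y\<in>spins d. ising_weight \<theta> G w y)"
    by (intro sum_pos) (auto simp: ising_weight_def)
  then show ?thesis
    by (simp add: p sum_divide_distrib[symmetric])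
qed

lemma emeasure_ising_iid:
  assumes p: "\<And>x. x \<in> spins d \<Longrightarrow> p x = ising_weight \<theta> G w x / (\<Sum>y\<in>spins d. ising_weight \<theta> G w y)"
    and A: "A \<subseteq> (\<Pi>\<^sub>E i\<in>{..<n}. spins d)"
  shows "emeasure (ising_iid n d \<theta> G w) A = ennreal (\<Sum>X\<in>A. \<Prod>i<n. p (X i))"
proof -
  have fin: "finite (spins d)"
    by (simp add: spins_eq_spin_cube finite_spin_cube)
  have nonneg: "0 \<le> p x" if "x \<in> spins d" for x
    unfolding p[OF that] by (intro divide_nonneg_nonneg sum_nonneg) (auto simp: ising_weight_def)
  have "ising d \<theta> G w = point_measure (spins d) (\<lambda>x. ennreal (p x))"
    unfolding ising_def point_measure_def
    by (intro density_cong) (auto simp: p)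
  then show ?thesis
    unfolding ising_iid_def
    using emeasure_PiM_point_measure[OF fin _ nonneg sum_ising_density[OF p] A] by simp
qed

lemma space_ising_iid: "space (ising_iid n d \<theta> G w) = (\<Pi>\<^sub>E i\<in>{..<n}. spins d)"
  by (simp add: ising_iid_def space_PiM ising_def space_point_measure)

section \<open>Planted cliques in the alternative\<close>

lemma degree_all_pairs_le:
  assumes "finite S"
  shows "card {e \<in> all_pairs S. v \<in> e} \<le> card S - 1"
proof (cases "v \<in> S")
  case True
  have "{e \<in> all_pairs S. v \<in> e} \<subseteq> (\<lambda>u. {v, u}) ` (S - {v})"
  proof
    fix e assume e: "e \<in> {e \<in> all_pairs S. v \<in> e}"
    then obtain a b where "e = {a, b}" "a \<noteq> b"
      by (auto simp: all_pairs_def card_2_iff)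
    then show "e \<in> (\<lambda>u. {v, u}) ` (S - {v})"
      using e by (auto simp: all_pairs_def insert_commute)
  qed
  then have "card {e \<in> all_pairs S. v \<in> e} \<le> card (S - {v})"
    using assms by (meson card_image_le card_mono finite_Diff finite_imageI le_trans)
  then show ?thesis using True assms by simp
next
  case False
  then have "{e \<in> all_pairs S. v \<in> e} = {}" by (auto simp: all_pairs_def)
  then show ?thesis by (simp only: card.empty)
qed

lemma simple_graph_clique: "finite V \<Longrightarrow> S \<subseteq> V \<Longrightarrow> simple_graph (V, all_pairs S)"
  by (auto simp: simple_graph_def all_pairs_def)

text \<open>
  A clique with one vertex more than \<open>s\<close> still has maximum degree at most \<open>s\<close>. This makes room for
  an even number of vertices.
\<close>

lemma planted_clique_in_class:
  assumes "graph_property P" and "strongly_monotone P" and "P (clique_graph s)"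
    and "S \<subseteq> {1..d}" and "s \<le> card S" and "card S \<le> s + 1"
  shows "planted_clique d S \<in> property_class P d True \<inter> maxdeg_le s"
proof -
  have fin: "finite S" using assms(4) finite_subset by auto
  obtain f :: "nat \<Rightarrow> nat" where f: "inj_on f {1..s}" "f ` {1..s} \<subseteq> S"
    using card_le_inj[of "{1..s}" S] fin assms(5) by auto
  have "P (f ` fst G, (`) f ` snd G) = P G" if "simple_graph G" "inj_on f (fst G)" for G
    using assms(1) that unfolding graph_property_def by blast
  from this[of "clique_graph s"] have "P (clique_graph s) = P (f ` {1..s}, (`) f ` all_pairs {1..s})"
    using f(1) simple_graph_clique[of "{1..s}" "{1..s}"] by (simp add: clique_graph_def)
  moreover have sub: "(`) f ` all_pairs {1..s} \<subseteq> all_pairs (f ` {1..s})"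
  proof
    fix e assume "e \<in> (`) f ` all_pairs {1..s}"
    then obtain e' where e': "e = f ` e'" "e' \<subseteq> {1..s}" "card e' = 2"
      by (auto simp: all_pairs_def)
    then have "card e = 2"
      using card_image[OF inj_on_subset[OF f(1) e'(2)]] by simp
    then show "e \<in> all_pairs (f ` {1..s})"
      using e' by (auto simp: all_pairs_def)
  qed
  moreover have "simple_graph (f ` {1..s}, (`) f ` all_pairs {1..s})"
    using sub by (simp add: simple_graph_def)
  moreover have simple: "simple_graph (planted_clique d S)"
    unfolding planted_clique_def using assms(4) by (intro simple_graph_clique) auto
  moreover have "subgraph (f ` {1..s}, (`) f ` all_pairs {1..s}) (planted_clique d S)"
  proof -
    have "all_pairs (f ` {1..s}) \<subseteq> all_pairs S"
      using f(2) unfolding all_pairs_def by blast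
    then have "(`) f ` all_pairs {1..s} \<subseteq> all_pairs S"
      using sub by (rule order_trans[rotated])
    moreover have "f ` {1..s} \<subseteq> {1..d}"
      using f(2) assms(4) by (rule order_trans)
    ultimately show ?thesis
      by (simp only: subgraph_def planted_clique_def fst_conv snd_conv simp_thms)
  qed
  ultimately have "P (planted_clique d S)"
    using assms(2)[unfolded strongly_monotone_def, rule_format, OF conjI[OF _ conjI]] assms(3)
    by (simp only: le_bool_def)
  moreover have "degree (planted_clique d S) v \<le> s" for v
    using degree_all_pairs_le[OF fin, of v] assms(6) by (simp add: degree_def planted_clique_def)
  ultimately show ?thesis
    using simple
    by (auto simp: property_class_def graphs_on_def maxdeg_le_def maxdeg_def planted_clique_def)
qed

lemma edgeless_graph_in_class:
  assumes "\<not> P (edgeless_graph d)"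
  shows "edgeless_graph d \<in> property_class P d False \<inter> maxdeg_le s"
proof -
  have "degree (edgeless_graph d) v = 0" for v
    by (simp add: degree_def edgeless_graph_def)
  then show ?thesis
    using assms by (auto simp: property_class_def graphs_on_def maxdeg_le_def maxdeg_def
      simple_graph_def edgeless_graph_def)
qed

section \<open>A lower bound on the minimax risk\<close>

text \<open>
  An upper bound for the mean of \<open>overlap_bound m (k div 2) ^ n\<close>, where \<open>k\<close> is the size of the
  intersection of two independent uniform subsets of \<open>{1..d}\<close> with \<open>2 m\<close> elements.
\<close>

definition overlap_moment :: "nat \<Rightarrow> nat \<Rightarrow> nat \<Rightarrow> real" where
  "overlap_moment n d m = (\<Sum>k\<le>2 * m. real ((2 * m) choose k) * (real (2 * m) / real d) ^ k
     * overlap_bound m (k div 2) ^ n)"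

text \<open>
  The square of the mixture is a double sum over pairs of cliques, and for each pair the sum over
  the \<open>n\<close> observations is the \<open>n\<close>-th power of the sum over one observation. The left-hand side is 1
  plus the chi-square distance between the mixture and the null law.
\<close>

lemma planted_clique_second_moment:
  fixes p :: "nat set \<Rightarrow> (nat \<Rightarrow> real) \<Rightarrow> real"
  assumes "0 \<le> \<theta>" and "2 * m \<le> d"
    and p: "\<And>S x. p S x = repulsion \<theta> (2 * m) (\<Sum>u\<in>S. x u)
      / (2 ^ d * walk_avg (2 * m) (repulsion \<theta> (2 * m)) 0)"
    and T: "T = {S. S \<subseteq> {1..d} \<and> card S = 2 * m}"
  shows "(\<Sum>X\<in>(\<Pi>\<^sub>E i\<in>{..<n}. spins d).
      ((\<Sum>S\<in>T. \<Prod>i<n. p S (X i)) / card T)\<^sup>2 / (\<Prod>i<n. 1 / 2 ^ d)) \<le> overlap_moment n d m"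
proof -
  define f where "f = repulsion \<theta> (2 * m)"
  define F where "F = walk_avg (2 * m) f 0"
  define N where "N = real (card T)"
  define ob where "ob k = overlap_bound m (k div 2) ^ n" for k
  have fpos: "0 < f a" for a
    by (simp add: f_def repulsion_pos)
  have Fpos: "0 < F"
    unfolding F_def using fpos by (rule walk_avg_pos)
  have finT: "finite T"
    unfolding T by (rule finite_subset[of _ "Pow {1..d}"]) auto
  have cT: "card T = d choose (2 * m)"
    unfolding T using n_subsets[of "{1..d}" "2 * m"] by simp
  then have N: "0 < N" "N = real (d choose (2 * m))"
    using assms(2) by (auto simp: N_def)
  have finO: "finite (spins d)"
    by (simp add: spins_eq_spin_cube finite_spin_cube)
  have pair: "(\<Sum>x\<in>spins d. p S x * p S' x * 2 ^ d) \<le> overlap_bound m (card (S \<inter> S') div 2)"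
    if "S \<in> T" "S' \<in> T" for S S'
  proof -
    have "(\<Sum>x\<in>spins d. p S x * p S' x * 2 ^ d)
        = (\<Sum>x\<in>spins d. f (\<Sum>u\<in>S. x u) * f (\<Sum>u\<in>S'. x u)) / (2 ^ d * F\<^sup>2)"
      unfolding sum_divide_distrib
      by (intro sum.cong refl) (simp add: p f_def[symmetric] F_def[symmetric] power2_eq_square)
    also have "\<dots> \<le> overlap_bound m (card (S \<inter> S') div 2)"
      using sum_spin_cube_two_magnetizations[of "{1..d}" S S' m f] that Fpos
        sym_unimodal_repulsion[OF assms(1), of "2 * m"] fpos
      by (simp add: T f_def[symmetric] F_def[symmetric] spins_eq_spin_cube less_imp_le divide_le_eq)
    finally show ?thesis .
  qed
  have pnonneg: "0 \<le> p S x" for S x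
    using Fpos fpos by (simp add: p f_def[symmetric] F_def[symmetric] less_imp_le)
  have "(\<Sum>X\<in>(\<Pi>\<^sub>E i\<in>{..<n}. spins d).
        ((\<Sum>S\<in>T. \<Prod>i<n. p S (X i)) / card T)\<^sup>2 / (\<Prod>i<n. 1 / 2 ^ d))
      = (\<Sum>X\<in>(\<Pi>\<^sub>E i\<in>{..<n}. spins d).
        \<Sum>S'\<in>T. \<Sum>S\<in>T. (\<Prod>i<n. p S (X i) * p S' (X i) * 2 ^ d) / N\<^sup>2)"
  proof (intro sum.cong refl)
    fix X
    have "((\<Sum>S\<in>T. \<Prod>i<n. p S (X i)) / N)\<^sup>2 / (\<Prod>i<n. 1 / 2 ^ d)
        = (\<Sum>S\<in>T. \<Prod>i<n. p S (X i)) * (\<Sum>S'\<in>T. \<Prod>i<n. p S' (X i)) * ((2 ^ d) ^ n / N\<^sup>2)"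
      by (simp add: power2_eq_square power_divide)
    also have "\<dots> = (\<Sum>S\<in>T. \<Sum>S'\<in>T. (\<Prod>i<n. p S (X i)) * (\<Prod>i<n. p S' (X i)) * ((2 ^ d) ^ n / N\<^sup>2))"
      by (simp only: sum_product) (simp only: sum_distrib_right)
    also have "\<dots> = (\<Sum>S\<in>T. \<Sum>S'\<in>T. (\<Prod>i<n. p S (X i) * p S' (X i) * 2 ^ d) / N\<^sup>2)"
      by (simp add: prod.distrib)
    also have "\<dots> = (\<Sum>S'\<in>T. \<Sum>S\<in>T. (\<Prod>i<n. p S (X i) * p S' (X i) * 2 ^ d) / N\<^sup>2)"
      by (rule sum.swap)
    finally show "((\<Sum>S\<in>T. \<Prod>i<n. p S (X i)) / card T)\<^sup>2 / (\<Prod>i<n. 1 / 2 ^ d)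
        = (\<Sum>S'\<in>T. \<Sum>S\<in>T. (\<Prod>i<n. p S (X i) * p S' (X i) * 2 ^ d) / N\<^sup>2)"
      by (simp only: N_def)
  qed
  also have "\<dots> = (\<Sum>S'\<in>T. \<Sum>S\<in>T.
      (\<Sum>X\<in>(\<Pi>\<^sub>E i\<in>{..<n}. spins d). \<Prod>i<n. p S (X i) * p S' (X i) * 2 ^ d) / N\<^sup>2)"
    by (subst sum.swap, intro sum.cong refl, subst sum.swap) (simp add: sum_divide_distrib)
  also have "\<dots> = (\<Sum>S'\<in>T. \<Sum>S\<in>T. (\<Sum>x\<in>spins d. p S x * p S' x * 2 ^ d) ^ n / N\<^sup>2)"
    using finO by (subst prod_sum_PiE[symmetric]) auto
  also have "\<dots> \<le> (\<Sum>S'\<in>T. \<Sum>S\<in>T. ob (card (S \<inter> S')) / N\<^sup>2)"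
    unfolding ob_def using pair pnonneg
    by (intro sum_mono divide_right_mono power_mono sum_nonneg) auto
  also have "\<dots> \<le> (\<Sum>S'\<in>T. (N * overlap_moment n d m) / N\<^sup>2)"
  proof (intro sum_mono)
    fix S' assume S': "S' \<in> T"
    have "(\<Sum>S\<in>T. ob (card (S \<inter> S'))) \<le> N * overlap_moment n d m"
      unfolding T N(2) overlap_moment_def ob_def[symmetric]
      using sum_overlap_le[of "{1..d}" S' "2 * m" ob] S' overlap_bound_ge_1
      by (simp add: T ob_def order_trans[OF zero_le_one])
    then show "(\<Sum>S\<in>T. ob (card (S \<inter> S')) / N\<^sup>2) \<le> (N * overlap_moment n d m) / N\<^sup>2"
      unfolding sum_divide_distrib[symmetric] by (rule divide_right_mono) simp
  qed
  also have "\<dots> = overlap_moment n d m"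
    using N(1) by (simp add: N_def[symmetric] power2_eq_square)
  finally show ?thesis .
qed

lemma worst_error_ge:
  assumes "G \<in> \<G>" and "w \<in> signs d"
  shows "emeasure (ising_iid n d \<theta> G w) {X \<in> (\<Pi>\<^sub>E i\<in>{..<n}. spins d). \<psi> X = b}
       \<le> worst_error n d \<theta> \<G> \<psi> b"
  unfolding worst_error_def space_ising_iid[symmetric, of n d \<theta> G w]
  by (rule SUP_upper2[OF assms(2)], rule SUP_upper2[OF assms(1)]) simp

text \<open>
  The supremum over the alternative is at least the average over the planted cliques. The bound does
  not depend on \<open>\<theta>\<close>.
\<close>

lemma minimax_risk_ge:
  assumes P: "graph_property P" "strongly_monotone P" "P (clique_graph s)" "\<not> P (edgeless_graph d)"
    and m: "s \<le> 2 * m" "2 * m \<le> s + 1" "2 * m \<le> d" and "0 \<le> \<theta>"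
  shows "ennreal (1 - sqrt (overlap_moment n d m - 1)) \<le> minimax_risk n d P (maxdeg_le s) \<theta>"
  unfolding minimax_risk_def
proof (rule INF_greatest)
  fix \<psi>
  define T where "T = {S. S \<subseteq> {1..d} \<and> card S = 2 * m}"
  define \<Omega> where "\<Omega> = (\<Pi>\<^sub>E i\<in>{..<n}. spins d)"
  define f where "f = repulsion \<theta> (2 * m)"
  define F where "F = walk_avg (2 * m) f 0"
  define p where "p S x = f (\<Sum>u\<in>S. x u) / (2 ^ d * F)" for S and x :: "nat \<Rightarrow> real"
  define q where "q X = (\<Prod>i<n. 1 / 2 ^ d :: real)" for X :: "nat \<Rightarrow> nat \<Rightarrow> real"
  define r where "r X = (\<Sum>S\<in>T. \<Prod>i<n. p S (X i)) / card T" for X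
  define A where "A = {X \<in> \<Omega>. \<psi> X = True}"
  let ?E0 = "worst_error n d \<theta> (property_class P d False \<inter> maxdeg_le s) \<psi> True"
  let ?E1 = "worst_error n d \<theta> (property_class P d True \<inter> maxdeg_le s) \<psi> False"
  have A: "A \<subseteq> \<Omega>" "\<Omega> - A = {X \<in> \<Omega>. \<psi> X = False}"
    by (auto simp: A_def)
  have finT: "finite T"
    unfolding T_def by (rule finite_subset[of _ "Pow {1..d}"]) auto
  have cT: "0 < card T"
    unfolding T_def using n_subsets[of "{1..d}" "2 * m"] m(3) by simp
  have finO: "finite (spins d)" "card (spins d) = 2 ^ d"
    by (auto simp: spins_eq_spin_cube finite_spin_cube card_spin_cube)
  have fin\<Omega>: "finite \<Omega>"
    using finO by (simp add: \<Omega>_def finite_PiE)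
  have sum\<Omega>: "(\<Sum>X\<in>\<Omega>. \<Prod>i<n. g (X i)) = 1" if "sum g (spins d) = 1" for g :: "_ \<Rightarrow> real"
    unfolding \<Omega>_def by (rule sum_PiE_prod_eq_1[OF finO(1) that])

  have null: "(1 / 2 ^ d :: real) = ising_weight \<theta> (edgeless_graph d) (repulsive_signs d) x
      / (\<Sum>y\<in>spins d. ising_weight \<theta> (edgeless_graph d) (repulsive_signs d) y)" for x
    by (simp add: ising_weight_edgeless finO)
  have planted: "p S x = ising_weight \<theta> (planted_clique d S) (repulsive_signs d) x
      / (\<Sum>y\<in>spins d. ising_weight \<theta> (planted_clique d S) (repulsive_signs d) y)"
    if "S \<in> T" "x \<in> spins d" for S x
  proof -
    have "(\<Sum>y\<in>spins d. ising_weight \<theta> (planted_clique d S) (repulsive_signs d) y)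
        = (\<Sum>y\<in>spins d. f (\<Sum>u\<in>S. y u))"
      using that by (intro sum.cong) (auto simp: ising_weight_planted_clique T_def f_def)
    also have "\<dots> = 2 ^ d * F"
      using that sum_spin_cube_magnetization[of "{1..d}" S f]
      by (simp add: T_def F_def spins_eq_spin_cube)
    finally show ?thesis
      using that by (simp add: p_def ising_weight_planted_clique T_def f_def)
  qed

  have "ennreal (sum q A) \<le> ?E0"
  proof -
    have "ennreal (sum q A) = emeasure (ising_iid n d \<theta> (edgeless_graph d) (repulsive_signs d)) A"
      unfolding q_def using A(1) unfolding \<Omega>_def
      by (rule emeasure_ising_iid[where p = "\<lambda>_. 1 / 2 ^ d", OF null, symmetric])
    also have "\<dots> \<le> ?E0"
      unfolding A_def \<Omega>_def
      by (rule worst_error_ge[OF edgeless_graph_in_class[where P = P, OF P(4)] repulsive_signs_in_signs])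
    finally show ?thesis .
  qed
  moreover have "ennreal (sum r (\<Omega> - A)) \<le> ?E1"
  proof -
    have E1: "ennreal (\<Sum>X\<in>\<Omega> - A. \<Prod>i<n. p S (X i)) \<le> ?E1" if "S \<in> T" for S
    proof -
      have "planted_clique d S \<in> property_class P d True \<inter> maxdeg_le s"
        using that m by (intro planted_clique_in_class P) (auto simp: T_def)
      then have "emeasure (ising_iid n d \<theta> (planted_clique d S) (repulsive_signs d)) (\<Omega> - A) \<le> ?E1"
        unfolding A(2) unfolding \<Omega>_def by (rule worst_error_ge[OF _ repulsive_signs_in_signs])
      also have "emeasure (ising_iid n d \<theta> (planted_clique d S) (repulsive_signs d)) (\<Omega> - A)
          = ennreal (\<Sum>X\<in>\<Omega> - A. \<Prod>i<n. p S (X i))"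
        by (rule emeasure_ising_iid[OF planted[OF that]]) (auto simp: \<Omega>_def)
      finally show ?thesis .
    qed
    have "\<exists>S\<in>T. sum r (\<Omega> - A) \<le> (\<Sum>X\<in>\<Omega> - A. \<Prod>i<n. p S (X i))"
    proof (rule ccontr)
      assume "\<not> ?thesis"
      then have less: "(\<Sum>X\<in>\<Omega> - A. \<Prod>i<n. p S (X i)) < sum r (\<Omega> - A)" if "S \<in> T" for S
        using that by (meson not_le)
      have "(\<Sum>S\<in>T. \<Sum>X\<in>\<Omega> - A. \<Prod>i<n. p S (X i)) < (\<Sum>S\<in>T. sum r (\<Omega> - A))"
      proof (intro sum_strict_mono[OF finT])
        show "T \<noteq> {}" using cT by auto
      qed (rule less)
      also have "\<dots> = (\<Sum>X\<in>\<Omega> - A. \<Sum>S\<in>T. \<Prod>i<n. p S (X i))"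
      proof -
        have "(\<Sum>S\<in>T. sum r (\<Omega> - A)) = (\<Sum>X\<in>\<Omega> - A. card T * r X)"
          by (simp add: sum_distrib_left)
        also have "\<dots> = (\<Sum>X\<in>\<Omega> - A. \<Sum>S\<in>T. \<Prod>i<n. p S (X i))"
          using cT by (simp add: r_def)
        finally show ?thesis .
      qed
      also have "\<dots> = (\<Sum>S\<in>T. \<Sum>X\<in>\<Omega> - A. \<Prod>i<n. p S (X i))"
        by (rule sum.swap)
      finally show False by simp
    qed
    then show ?thesis
      using E1 by (meson ennreal_leI order_trans)
  qed
  ultimately have risk: "ennreal (sum q A) + ennreal (sum r (\<Omega> - A)) \<le> ?E0 + ?E1"
    by (rule add_mono)

  have "sum r \<Omega> = (\<Sum>S\<in>T. \<Sum>X\<in>\<Omega>. \<Prod>i<n. p S (X i)) / card T"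
    unfolding r_def sum_divide_distrib[symmetric] by (subst sum.swap) simp
  also have "\<dots> = 1"
    using cT sum_ising_density[OF planted] by (simp add: sum\<Omega>)
  finally have "sum r \<Omega> = 1" .
  moreover have "sum q \<Omega> = 1"
    unfolding q_def using finO by (intro sum\<Omega>) simp
  ultimately have chi: "1 - sqrt ((\<Sum>X\<in>\<Omega>. (r X)\<^sup>2 / q X) - 1) \<le> sum q A + sum r (\<Omega> - A)"
    using fin\<Omega> A(1) by (intro testing_error_ge_chi_square) (auto simp: q_def)
  have "(\<Sum>X\<in>\<Omega>. (r X)\<^sup>2 / q X) \<le> overlap_moment n d m"
    unfolding r_def q_def \<Omega>_def
    by (rule planted_clique_second_moment[OF \<open>0 \<le> \<theta>\<close> m(3)]) (simp_all add: p_def T_def F_def f_def)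
  then have "1 - sqrt (overlap_moment n d m - 1) \<le> 1 - sqrt ((\<Sum>X\<in>\<Omega>. (r X)\<^sup>2 / q X) - 1)"
    by simp
  also note chi
  finally have "ennreal (1 - sqrt (overlap_moment n d m - 1)) \<le> ennreal (sum q A + sum r (\<Omega> - A))"
    by (rule ennreal_leI)
  also have "\<dots> = ennreal (sum q A) + ennreal (sum r (\<Omega> - A))"
  proof (rule ennreal_plus)
    have "0 < F"
      unfolding F_def f_def by (intro walk_avg_pos repulsion_pos)
    then show "0 \<le> sum r (\<Omega> - A)"
      unfolding r_def p_def f_def
      by (intro sum_nonneg divide_nonneg_nonneg prod_nonneg) (auto simp: repulsion_pos less_imp_le)
  qed (simp add: q_def sum_nonneg)
  also note risk
  finally show "ennreal (1 - sqrt (overlap_moment n d m - 1)) \<le> ?E0 + ?E1" .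
qed

lemma minimax_risk_le_1: "minimax_risk n d P \<R> \<theta> \<le> 1"
proof -
  have "(\<lambda>_. False) \<in> tests n d"
    by (simp add: tests_def)
  then have "minimax_risk n d P \<R> \<theta>
      \<le> worst_error n d \<theta> (property_class P d False \<inter> \<R>) (\<lambda>_. False) True
      + worst_error n d \<theta> (property_class P d True \<inter> \<R>) (\<lambda>_. False) False"
    unfolding minimax_risk_def by (rule INF_lower)
  also have "\<dots> \<le> 0 + 1"
  proof (rule add_mono)
    show "worst_error n d \<theta> (property_class P d False \<inter> \<R>) (\<lambda>_. False) True \<le> 0"
      unfolding worst_error_def by (intro SUP_least) simp
    show "worst_error n d \<theta> (property_class P d True \<inter> \<R>) (\<lambda>_. False) False \<le> 1"
      unfolding worst_error_def
    proof (intro SUP_least)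
      fix w G
      have "emeasure (ising_iid n d \<theta> G w) (\<Pi>\<^sub>E i\<in>{..<n}. spins d) = ennreal 1"
        unfolding emeasure_ising_iid[OF refl order_refl]
        by (intro arg_cong[of _ _ ennreal] sum_PiE_prod_eq_1 sum_ising_density[OF refl])
          (simp add: spins_eq_spin_cube finite_spin_cube)
      then show "emeasure (ising_iid n d \<theta> G w) {X \<in> space (ising_iid n d \<theta> G w). False = False} \<le> 1"
        by (simp add: space_ising_iid)
    qed
  qed
  finally show ?thesis by simp
qed


section \<open>Growth of the return probability ratios\<close>

lemma return_ratio_antimono:
  assumes "1 \<le> i" and "i \<le> j"
  shows "return_ratio j \<le> return_ratio i"
  using assms by (simp add: return_ratio_def divide_simps algebra_simps)

text \<open>
  For an overlap of at most half of the clique all factors involved have index above \<open>m / 2\<close>, hence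
  are at most \<open>1 + 1 / m\<close>. Their product stays bounded, so this estimate does not lose the
  logarithmic factor that the next ones do.
\<close>

lemma overlap_bound_le_exp:
  assumes "2 * h \<le> m"
  shows "overlap_bound m h \<le> exp (real h / real m)"
proof (cases "m = 0")
  case False
  have "return_ratio i \<le> exp (1 / real m)" if "i \<in> {m - h<..m}" for i
  proof -
    have i: "real m \<le> 2 * real i - 1" using that assms by auto
    then have "return_ratio i = 1 + 1 / (2 * real i - 1)"
      using False by (simp add: return_ratio_def field_simps)
    also have "\<dots> \<le> 1 + 1 / real m"
      using i False by (intro add_left_mono divide_left_mono) auto
    also have "\<dots> \<le> exp (1 / real m)"
      by (rule exp_ge_add_one_self)
    finally show ?thesis .
  qed
  then have "overlap_bound m h \<le> (\<Prod>i\<in>{m - h<..m}. exp (1 / real m))"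
    unfolding overlap_bound_def
    by (intro prod_mono conjI order_trans[OF zero_le_one return_ratio_ge_1]) auto
  also have "\<dots> = exp (real h / real m)"
    using assms by (simp add: exp_of_nat_mult[symmetric])
  finally show ?thesis .
qed (use assms in \<open>simp add: overlap_bound_def\<close>)

text \<open>
  The return probability at time \<open>2 m\<close> is at least \<open>1 / (2 sqrt m)\<close>. The induction is on the
  squares, where the step is \<open>4 m (m + 1) \<le> (2 m + 1)\<^sup>2\<close>.
\<close>

lemma overlap_bound_full_le:
  assumes "1 \<le> m"
  shows "(overlap_bound m m)\<^sup>2 \<le> 4 * real m"
  using assms
proof (induction m rule: nat_induct_at_least)
  case base
  have "{0<..Suc 0} = {1}" by auto
  then show ?case by (simp add: overlap_bound_def return_ratio_def)
next
  case (Suc m)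
  have "{0<..Suc m} = insert (Suc m) {0<..m}" by auto
  then have "(overlap_bound (Suc m) (Suc m))\<^sup>2 = (return_ratio (Suc m))\<^sup>2 * (overlap_bound m m)\<^sup>2"
    by (simp add: overlap_bound_def power_mult_distrib)
  also have "\<dots> \<le> (return_ratio (Suc m))\<^sup>2 * (4 * real m)"
    using Suc.IH by (rule mult_left_mono) simp
  also have "\<dots> \<le> 4 * real (Suc m)"
    by (simp add: return_ratio_def power_divide divide_simps) (simp add: power2_eq_square algebra_simps)
  finally show ?case .
qed

text \<open>
  The return ratios decrease, so the geometric mean of the last \<open>h\<close> of them is at most the geometric
  mean of all \<open>m\<close>. Large overlaps are charged in proportion to their size, which the entropy of
  the overlap can compensate.
\<close>

lemma overlap_bound_power_le:
  assumes "h \<le> m"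
  shows "overlap_bound m h ^ m \<le> overlap_bound m m ^ h"
proof (cases "h = m")
  case False
  then have lt: "h < m" using assms by simp
  \<comment> \<open>The smallest of the first \<open>m - h\<close> ratios; the last \<open>h\<close> ratios lie below it.\<close>
  define c where "c = return_ratio (m - h)"
  define lo where "lo = (\<Prod>i\<in>{0<..m - h}. return_ratio i)"
  define hi where "hi = overlap_bound m h"
  have c: "1 \<le> c" using lt by (simp add: c_def return_ratio_ge_1)
  have pos: "0 \<le> hi" "0 \<le> lo" "1 \<le> lo"
    using overlap_bound_ge_1[of m h] by (auto simp: hi_def lo_def intro!: prod_nonneg prod_ge_1 return_ratio_ge_1 order_trans[OF zero_le_one return_ratio_ge_1])
  have "hi \<le> (\<Prod>i\<in>{m - h<..m}. c)"
    unfolding hi_def overlap_bound_def c_def using lt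
    by (intro prod_mono conjI return_ratio_antimono order_trans[OF zero_le_one return_ratio_ge_1]) auto
  then have hi: "hi \<le> c ^ h"
    using assms by simp
  have "(\<Prod>i\<in>{0<..m - h}. c) \<le> lo"
    unfolding lo_def c_def using c
    by (intro prod_mono conjI return_ratio_antimono) (auto simp: c_def)
  then have lo: "c ^ (m - h) \<le> lo"
    by simp
  have "hi ^ (m - h) \<le> (c ^ h) ^ (m - h)"
    using hi pos by (intro power_mono)
  also have "\<dots> = (c ^ (m - h)) ^ h"
    by (simp add: power_mult[symmetric] mult.commute)
  also have "\<dots> \<le> lo ^ h"
    using lo c by (intro power_mono) auto
  finally have "hi ^ (m - h) * hi ^ h \<le> lo ^ h * hi ^ h"
    using pos by (intro mult_right_mono) auto
  moreover have "hi ^ (m - h) * hi ^ h = hi ^ m"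
    using assms by (simp add: power_add[symmetric])
  moreover have "overlap_bound m m = lo * hi"
  proof -
    have "{0<..m} = {0<..m - h} \<union> {m - h<..m}" using assms by auto
    moreover have "{0<..m - h} \<inter> {m - h<..m} = {}" by auto
    ultimately show ?thesis
      by (simp add: overlap_bound_def lo_def hi_def prod.union_disjoint)
  qed
  ultimately show ?thesis
    by (simp add: hi_def power_mult_distrib)
qed simp

lemma overlap_bound_le_exp_ln:
  assumes "1 \<le> m" and "h \<le> m"
  shows "overlap_bound m h \<le> exp (real h * ln (4 * real m) / (2 * real m))"
proof -
  have ge1: "1 \<le> overlap_bound m h" "1 \<le> overlap_bound m m"
    by (simp_all add: overlap_bound_ge_1)
  have "real m * ln (overlap_bound m h) = ln (overlap_bound m h ^ m)"
    using ge1 by (simp add: ln_realpow)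
  also have "\<dots> \<le> ln (overlap_bound m m ^ h)"
    using overlap_bound_power_le[OF assms(2)] ge1 by (intro ln_mono) auto
  also have "\<dots> = real h * ln (overlap_bound m m)"
    using ge1 by (simp add: ln_realpow)
  also have "\<dots> \<le> real h * (ln (4 * real m) / 2)"
  proof (rule mult_left_mono)
    have "2 * ln (overlap_bound m m) = ln ((overlap_bound m m)\<^sup>2)"
      using ge1 by (simp add: ln_realpow)
    also have "\<dots> \<le> ln (4 * real m)"
      using overlap_bound_full_le[OF assms(1)] ge1 by (intro ln_mono) auto
    finally show "ln (overlap_bound m m) \<le> ln (4 * real m) / 2" by simp
  qed simp
  finally have "ln (overlap_bound m h) \<le> real h * ln (4 * real m) / (2 * real m)"
    using assms(1) by (simp add: field_simps)
  then show ?thesis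
    using ge1 by (metis exp_le_cancel_iff exp_ln less_le_trans zero_less_one)
qed

text \<open>
  Rounding \<open>s\<close> up to an even number does not increase \<open>ln x / x\<close> at \<open>x = 2 s\<close>, because this function
  decreases for \<open>x \<ge> e\<close>. The remaining case \<open>s = 1\<close> is an equality, as \<open>ln 4 / 4 = ln 2 / 2\<close>.
\<close>

lemma ln_div_even_ceiling_le:
  assumes "1 \<le> s" and "s \<le> 2 * m" and "2 * m \<le> s + 1"
  shows "ln (4 * real m) / (4 * real m) \<le> ln (2 * real s) / (2 * real s)"
proof (cases "s = 2 * m")
  case False
  then have m: "4 * real m = 2 * real s + 2" using assms by linarith
  have x: "1 \<le> real s" using assms by simp
  have "real s * ln (2 * real s + 2) \<le> (real s + 1) * ln (2 * real s)"
  proof (cases "s = 1")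
    case True
    have "ln (4::real) = 2 * ln 2"
      using ln_realpow[of 2 2] by simp
    then show ?thesis using True by simp
  next
    case False
    have "ln (2 * real s + 2) = ln (2 * real s) + ln (1 + 1 / real s)"
    proof -
      have "2 * real s + 2 = 2 * real s * (1 + 1 / real s)"
        using x by (simp add: field_simps)
      then show ?thesis
        using x by (metis add_pos_pos divide_pos_pos ln_mult_pos mult_pos_pos order_less_le_trans zero_less_numeral zero_less_one)
    qed
    moreover have "ln (1 + 1 / real s) \<le> 1 / real s"
      using x by (intro ln_add_one_self_le_self) auto
    ultimately have "real s * ln (2 * real s + 2) \<le> real s * (ln (2 * real s) + 1 / real s)"
      by (intro mult_left_mono) auto
    also have "\<dots> = real s * ln (2 * real s) + 1"
      using x by (simp add: distrib_left)
    also have "1 \<le> ln (2 * real s)"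
    proof -
      have "exp 1 \<le> 2 * real s"
        using exp_le False assms(1) by linarith
      then show ?thesis using x by (subst ln_ge_iff) auto
    qed
    finally show ?thesis by (simp add: algebra_simps)
  qed
  then show ?thesis
    unfolding m using x by (simp add: field_simps)
qed simp

section \<open>The overlap moment in the regime of the theorem\<close>

lemma sum_power_le_geometric:
  assumes "0 \<le> \<rho>" and "\<rho> < 1"
  shows "(\<Sum>k=1..t. \<rho> ^ k) \<le> \<rho> / (1 - \<rho> :: real)"
proof -
  have "(\<Sum>k=1..t. \<rho> ^ k) = \<rho> * (\<Sum>k<t. \<rho> ^ k)"
    by (subst sum_distrib_left, rule sum.reindex_bij_witness[of _ Suc "\<lambda>k. k - 1"])
      (auto simp flip: power_Suc)
  also have "\<dots> \<le> \<rho> * (1 / (1 - \<rho>))"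
  proof (rule mult_left_mono)
    have "(\<Sum>k<t. \<rho> ^ k) = (1 - \<rho> ^ t) / (1 - \<rho>)"
      using assms by (simp add: sum_gp_strict)
    also have "\<dots> \<le> 1 / (1 - \<rho>)"
      using assms by (intro divide_right_mono) auto
    finally show "(\<Sum>k<t. \<rho> ^ k) \<le> 1 / (1 - \<rho>)" .
  qed (use assms in auto)
  finally show ?thesis by simp
qed

text \<open>
  The probability of the overlap is at most \<open>(4 s\<^sup>2 / d) ^ k\<close>, and the likelihood factor costs at
  most \<open>(d / s\<^sup>2) powr (k / 2)\<close>.
\<close>

lemma small_overlap_term_le:
  assumes s: "1 \<le> s" "s \<le> 2 * m" "2 * m \<le> 2 * s" and "0 < d" and "k \<le> m"
    and n: "2 * real n \<le> real s * ln (real d / (real s)\<^sup>2)"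
  shows "real ((2 * m) choose k) * (real (2 * m) / real d) ^ k * overlap_bound m (k div 2) ^ n
       \<le> (4 * exp (- ln (real d / (real s)\<^sup>2) / 2)) ^ k"
proof -
  define L where "L = ln (real d / (real s)\<^sup>2)"
  have expL: "exp (- L) = (real s)\<^sup>2 / real d"
    using s assms(4) by (simp add: L_def exp_minus)
  have m: "0 < real m" "real s \<le> 2 * real m" using s by auto
  have "real ((2 * m) choose k) * (real (2 * m) / real d) ^ k \<le> real (2 * m) ^ k * (real (2 * m) / real d) ^ k"
  proof (rule mult_right_mono)
    show "real ((2 * m) choose k) \<le> real (2 * m) ^ k"
    proof -
      have "((2 * m) choose k) * 1 \<le> ((2 * m) choose k) * fact k"
        by (intro mult_left_mono fact_ge_1) auto
      also have "\<dots> \<le> (2 * m) ^ k"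
        by (rule binomial_fact_pow)
      finally have "real (((2 * m) choose k) * 1) \<le> real ((2 * m) ^ k)"
        by (rule of_nat_mono)
      then show ?thesis by simp
    qed
  qed simp
  also have "\<dots> = ((real (2 * m))\<^sup>2 / real d) ^ k"
    by (subst power_mult_distrib[symmetric]) (simp only: power2_eq_square times_divide_eq_right)
  also have "\<dots> \<le> (4 * exp (- L)) ^ k"
  proof (rule power_mono)
    have "(real (2 * m))\<^sup>2 \<le> (real (2 * s))\<^sup>2"
      using s(3) by (intro power_mono) (auto simp only: of_nat_le_iff of_nat_0_le_iff)
    then show "(real (2 * m))\<^sup>2 / real d \<le> 4 * exp (- L)"
      unfolding expL by (simp add: power_mult_distrib divide_right_mono)
  qed simp
  finally have choose: "real ((2 * m) choose k) * (real (2 * m) / real d) ^ k \<le> (4 * exp (- L)) ^ k" .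
  have "overlap_bound m (k div 2) ^ n \<le> exp (real (k div 2) / real m) ^ n"
    using assms(5) order_trans[OF zero_le_one overlap_bound_ge_1]
    by (intro power_mono overlap_bound_le_exp) auto
  also have "\<dots> = exp (real n * (real (k div 2) / real m))"
    by (rule exp_of_nat_mult[symmetric])
  also have "\<dots> \<le> exp (real k * (L / 2))"
  proof (subst exp_le_cancel_iff)
    have "real n * (real (k div 2) / real m) \<le> (real s * L / 2) * (real k / 2 / real m)"
    proof (rule mult_mono)
      show "real n \<le> real s * L / 2" using n by (simp add: L_def)
      then show "0 \<le> real s * L / 2" by (rule order_trans[rotated]) simp
      have "real (k div 2) \<le> real k / 2" by linarith
      then show "real (k div 2) / real m \<le> real k / 2 / real m"
        by (rule divide_right_mono) simp
    qed simp
    also have "\<dots> = (real s / (2 * real m)) * (real k * (L / 2))"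
      by simp
    also have "\<dots> \<le> 1 * (real k * (L / 2))"
    proof (rule mult_right_mono)
      have "0 \<le> real s * L" using n unfolding L_def by (rule order_trans[rotated]) simp
      then have "0 \<le> L" using s(1) by (simp add: zero_le_mult_iff)
      then show "0 \<le> real k * (L / 2)" by simp
    qed (use m in simp)
    finally show "real n * (real (k div 2) / real m) \<le> real k * (L / 2)" by simp
  qed
  also have "\<dots> = exp (L / 2) ^ k"
    by (rule exp_of_nat_mult)
  finally have "real ((2 * m) choose k) * (real (2 * m) / real d) ^ k * overlap_bound m (k div 2) ^ n
      \<le> (4 * exp (- L)) ^ k * exp (L / 2) ^ k"
    using order_trans[OF zero_le_one overlap_bound_ge_1] by (intro mult_mono[OF choose]) auto
  also have "\<dots> = (4 * (exp (- L) * exp (L / 2))) ^ k"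
    by (simp only: power_mult_distrib mult.assoc)
  also have "exp (- L) * exp (L / 2) = exp (- L / 2)"
    unfolding exp_add[symmetric] by simp
  finally show ?thesis by (simp add: L_def)
qed

text \<open>
  Here \<open>(2 m) choose k \<le> 4 ^ k\<close> replaces \<open>(2 m) ^ k\<close>, because \<open>k\<close> exceeds half of the clique; so the
  probability of the overlap is at most \<open>(8 s / d) ^ k\<close>. The likelihood factor costs at most
  \<open>(d / (2 s)) powr (k / (1 + \<epsilon>))\<close>, and the margin \<open>\<epsilon>\<close> leaves a positive power of \<open>2 s / d\<close>.
\<close>

lemma large_overlap_term_le:
  assumes s: "1 \<le> s" "s \<le> 2 * m" "2 * m \<le> s + 1" and "0 < d" and k: "m < k" "k \<le> 2 * m"
    and n: "(1 + \<epsilon>) * (real n * ln (sqrt (2 * real s))) \<le> real s * ln (real d / (2 * real s))"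
    and "0 < \<epsilon>"
  shows "real ((2 * m) choose k) * (real (2 * m) / real d) ^ k * overlap_bound m (k div 2) ^ n
       \<le> (4 * exp (- (\<epsilon> / (1 + \<epsilon>)) * ln (real d / (2 * real s)))) ^ k"
proof -
  define L where "L = ln (real d / (2 * real s))"
  have expL: "exp (- L) = 2 * real s / real d"
    using s assms(4) by (simp add: L_def exp_minus)
  have m: "0 < real m" "1 \<le> m" using s by auto
  have "real ((2 * m) choose k) \<le> 4 ^ k"
  proof -
    have "(2 * m) choose k \<le> 2 ^ (2 * m)"
      by (rule binomial_le_pow2)
    also have "\<dots> = (4::nat) ^ m"
      by (simp add: power_mult)
    also have "\<dots> \<le> 4 ^ k"
      using k by (intro power_increasing) auto
    finally have "real ((2 * m) choose k) \<le> real (4 ^ k)"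
      by (rule of_nat_mono)
    then show ?thesis by simp
  qed
  moreover have "(real (2 * m) / real d) ^ k \<le> exp (- L) ^ k"
  proof (rule power_mono)
    have "real (2 * m) \<le> 2 * real s" using s by linarith
    then show "real (2 * m) / real d \<le> exp (- L)"
      unfolding expL by (rule divide_right_mono) simp
  qed simp
  ultimately have choose: "real ((2 * m) choose k) * (real (2 * m) / real d) ^ k \<le> 4 ^ k * exp (- L) ^ k"
    by (intro mult_mono) auto
  have "overlap_bound m (k div 2) ^ n \<le> exp (real (k div 2) * ln (4 * real m) / (2 * real m)) ^ n" (is "_ \<le> exp ?y ^ n")
    using k m order_trans[OF zero_le_one overlap_bound_ge_1]
    by (intro power_mono overlap_bound_le_exp_ln) auto
  also have "exp ?y ^ n = exp (real n * ?y)"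
    by (rule exp_of_nat_mult[symmetric])
  also have "\<dots> \<le> exp (real k * (L / (1 + \<epsilon>)))"
  proof (subst exp_le_cancel_iff)
    have "real (k div 2) * ln (4 * real m) / (2 * real m) = real (k div 2) * 2 * (ln (4 * real m) / (4 * real m))"
      by simp
    also have "\<dots> \<le> real k * (ln (2 * real s) / (2 * real s))"
    proof (rule mult_mono)
      have "0 \<le> ln (4 * real m)" using m by (intro ln_ge_zero) linarith
      then show "0 \<le> ln (4 * real m) / (4 * real m)" by simp
      show "real (k div 2) * 2 \<le> real k" by linarith
    qed (use ln_div_even_ceiling_le[OF s] in auto)
    finally have "real n * (real (k div 2) * ln (4 * real m) / (2 * real m))
        \<le> real n * (real k * (ln (2 * real s) / (2 * real s)))"
      by (rule mult_left_mono) simp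
    also have "\<dots> = real k * (real n * ln (sqrt (2 * real s)) / real s)"
      using s(1) by (simp add: ln_sqrt)
    also have "\<dots> \<le> real k * (L / (1 + \<epsilon>))"
      using n s(1) \<open>0 < \<epsilon>\<close> by (intro mult_left_mono) (simp_all add: L_def field_simps)
    finally show "real n * (real (k div 2) * ln (4 * real m) / (2 * real m)) \<le> real k * (L / (1 + \<epsilon>))" .
  qed
  also have "\<dots> = exp (L / (1 + \<epsilon>)) ^ k"
    by (rule exp_of_nat_mult)
  finally have "real ((2 * m) choose k) * (real (2 * m) / real d) ^ k * overlap_bound m (k div 2) ^ n
      \<le> (4 ^ k * exp (- L) ^ k) * exp (L / (1 + \<epsilon>)) ^ k"
    using order_trans[OF zero_le_one overlap_bound_ge_1] by (intro mult_mono[OF choose]) auto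
  also have "\<dots> = (4 * exp (- L + L / (1 + \<epsilon>))) ^ k"
    by (simp only: power_mult_distrib mult.assoc exp_add)
  also have "- L + L / (1 + \<epsilon>) = - (\<epsilon> / (1 + \<epsilon>)) * L"
    using \<open>0 < \<epsilon>\<close> by (simp add: field_simps)
  finally show ?thesis by (simp add: L_def)
qed

lemma overlap_moment_le:
  assumes s: "1 \<le> s" "s \<le> 2 * m" "2 * m \<le> s + 1" and "0 < d" and "0 < \<epsilon>"
    and n1: "2 * real n \<le> real s * ln (real d / (real s)\<^sup>2)"
    and n2: "(1 + \<epsilon>) * (real n * ln (sqrt (2 * real s))) \<le> real s * ln (real d / (2 * real s))"
    and \<rho>1: "\<rho>1 = 4 * exp (- ln (real d / (real s)\<^sup>2) / 2)" "\<rho>1 < 1"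
    and \<rho>2: "\<rho>2 = 4 * exp (- (\<epsilon> / (1 + \<epsilon>)) * ln (real d / (2 * real s)))" "\<rho>2 < 1"
  shows "overlap_moment n d m - 1 \<le> \<rho>1 / (1 - \<rho>1) + \<rho>2 / (1 - \<rho>2)"
proof -
  define a where "a k = real ((2 * m) choose k) * (real (2 * m) / real d) ^ k
     * overlap_bound m (k div 2) ^ n" for k
  have "{..2 * m} = insert 0 {1..2 * m}" by auto
  then have "overlap_moment n d m = a 0 + (\<Sum>k=1..2 * m. a k)"
    by (simp add: overlap_moment_def a_def)
  also have "a 0 = 1"
    by (simp add: a_def overlap_bound_def)
  also have "(\<Sum>k=1..2 * m. a k) \<le> (\<Sum>k=1..2 * m. \<rho>1 ^ k + \<rho>2 ^ k)"
  proof (rule sum_mono)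
    fix k assume k: "k \<in> {1..2 * m}"
    have pos: "0 \<le> \<rho>1 ^ k" "0 \<le> \<rho>2 ^ k" by (auto simp: \<rho>1(1) \<rho>2(1))
    show "a k \<le> \<rho>1 ^ k + \<rho>2 ^ k"
    proof (cases "k \<le> m")
      case True
      have "a k \<le> \<rho>1 ^ k"
        unfolding a_def \<rho>1(1) using s True by (intro small_overlap_term_le assms) auto
      then show ?thesis using pos by simp
    next
      case False
      have "a k \<le> \<rho>2 ^ k"
        unfolding a_def \<rho>2(1) using False k by (intro large_overlap_term_le assms) auto
      then show ?thesis using pos by simp
    qed
  qed
  also have "\<dots> = (\<Sum>k=1..2 * m. \<rho>1 ^ k) + (\<Sum>k=1..2 * m. \<rho>2 ^ k)"
    by (rule sum.distrib)
  also have "\<dots> \<le> \<rho>1 / (1 - \<rho>1) + \<rho>2 / (1 - \<rho>2)"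
    using \<rho>1 \<rho>2 by (intro add_mono sum_power_le_geometric) auto
  finally show ?thesis by simp
qed

section \<open>Impossibility of testing at any interaction strength\<close>

theorem theorem4p1:
  fixes d s :: "nat \<Rightarrow> nat"
    and P :: "nat \<Rightarrow> ugraph \<Rightarrow> bool"
    and \<epsilon> :: real
  assumes "filterlim d at_top sequentially"
    and "(\<lambda>n. real (s n)) \<in> o[sequentially](\<lambda>n. sqrt (real (d n)))"
    and "\<And>n. graph_property (P n)"
    and "\<And>n. strongly_monotone (P n)"
    and "\<forall>\<^sub>F n in sequentially. P n (edgeless_graph (d n)) = False"
    and "\<forall>\<^sub>F n in sequentially. P n (clique_graph (s n)) = True"
    and "\<epsilon> > 0"
    and "\<forall>\<^sub>F n in sequentially.
           real (s n) * ln (real (d n) / (real (s n))\<^sup>2) / real n > 2 + \<epsilon>"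
    and "\<forall>\<^sub>F n in sequentially.
           real (s n) * ln (real (d n) / (2 * real (s n))) / (real n * ln (sqrt (2 * real (s n))))
             \<ge> 1 + \<epsilon>"
  shows "liminf (\<lambda>n. INF \<theta>\<in>{0..}. minimax_risk n (d n) (P n) (maxdeg_le (s n)) \<theta>) = 1"
proof -
  \<comment> \<open>\<open>2 m\<close> is \<open>s\<close> rounded up to an even number.\<close>
  define m where "m n = (s n + 1) div 2" for n
  \<comment> \<open>The ratios of the two geometric series are \<open>4 s / sqrt d\<close> and \<open>4 (2 s / d) powr (\<epsilon> / (1 + \<epsilon>))\<close>.\<close>
  define \<rho>1 where "\<rho>1 n = 4 * exp (- ln (real (d n) / (real (s n))\<^sup>2) / 2)" for n
  define \<rho>2 where "\<rho>2 n = 4 * exp (- (\<epsilon> / (1 + \<epsilon>)) * ln (real (d n) / (2 * real (s n))))" for n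
  define e where "e n = \<rho>1 n / (1 - \<rho>1 n) + \<rho>2 n / (1 - \<rho>2 n)" for n
  define R where "R n = (INF \<theta>\<in>{0..}. minimax_risk n (d n) (P n) (maxdeg_le (s n)) \<theta>)" for n
  have ev_n: "\<forall>\<^sub>F n in sequentially. 0 < n"
    by (rule eventually_gt_at_top)
  have ev_d: "\<forall>\<^sub>F n in sequentially. 1 \<le> d n"
    using assms(1) by (simp add: filterlim_at_top)
  have ev_s: "\<forall>\<^sub>F n in sequentially. 1 \<le> s n"
    using assms(8)
  proof eventually_elim
    case (elim n)
    then show ?case using \<open>0 < \<epsilon>\<close> by (cases "s n = 0") auto
  qed
  have ratio: "(\<lambda>n. real (s n) / sqrt (real (d n))) \<longlonglongrightarrow> 0"
    using smalloD_tendsto[OF assms(2)] .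
  have inv: "(\<lambda>n. 1 / sqrt (real (d n))) \<longlonglongrightarrow> 0"
    by (intro tendsto_divide_0[OF tendsto_const] filterlim_at_top_imp_at_infinity
      filterlim_compose[OF sqrt_at_top] filterlim_compose[OF filterlim_real_sequentially] assms(1))
  have "\<forall>\<^sub>F n in sequentially. 4 * (real (s n) / sqrt (real (d n))) = \<rho>1 n"
    using ev_s ev_d
  proof eventually_elim
    case (elim n)
    have "ln (real (d n) / (real (s n))\<^sup>2) / 2 = ln (sqrt (real (d n) / (real (s n))\<^sup>2))"
      using elim by (simp add: ln_sqrt)
    also have "sqrt (real (d n) / (real (s n))\<^sup>2) = sqrt (real (d n)) / real (s n)"
      by (simp add: real_sqrt_divide)
    finally show ?case
      using elim by (simp add: \<rho>1_def exp_minus)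
  qed
  then have \<rho>1: "\<rho>1 \<longlonglongrightarrow> 0"
    using tendsto_mult_right_zero[OF ratio, of 4] by (rule Lim_transform_eventually[rotated])
  have "\<forall>\<^sub>F n in sequentially.
      4 * (2 * (real (s n) / sqrt (real (d n)) * (1 / sqrt (real (d n))))) powr (\<epsilon> / (1 + \<epsilon>)) = \<rho>2 n"
    using ev_s ev_d
  proof eventually_elim
    case (elim n)
    have "2 * (real (s n) / sqrt (real (d n)) * (1 / sqrt (real (d n))))
        = exp (- ln (real (d n) / (2 * real (s n))))"
      using elim by (simp add: exp_minus)
    then show ?case
      by (simp add: \<rho>2_def powr_def)
  qed
  moreover have "(\<lambda>n. 4 * (2 * (real (s n) / sqrt (real (d n)) * (1 / sqrt (real (d n)))))
      powr (\<epsilon> / (1 + \<epsilon>))) \<longlonglongrightarrow> 0"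
    using assms(7)
    by (intro tendsto_mult_right_zero tendsto_zero_powrI[where b = "\<epsilon> / (1 + \<epsilon>)"] tendsto_mult_zero ratio inv)
      auto
  ultimately have \<rho>2: "\<rho>2 \<longlonglongrightarrow> 0"
    by (rule Lim_transform_eventually[rotated])
  have "e \<longlonglongrightarrow> 0 / (1 - 0) + 0 / (1 - 0)"
    unfolding e_def by (intro tendsto_intros \<rho>1 \<rho>2) auto
  then have "(\<lambda>n. ennreal (1 - sqrt (e n))) \<longlonglongrightarrow> ennreal (1 - sqrt 0)"
    by (intro tendsto_intros) simp
  then have lower_lim: "(\<lambda>n. ennreal (1 - sqrt (e n))) \<longlonglongrightarrow> 1"
    by simp
  have "\<forall>\<^sub>F n in sequentially. \<rho>1 n < 1" "\<forall>\<^sub>F n in sequentially. \<rho>2 n < 1"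
    using \<rho>1 \<rho>2 by (auto intro: order_tendstoD(2))
  moreover have "\<forall>\<^sub>F n in sequentially. real (s n) / sqrt (real (d n)) < 1 / 2"
    using ratio by (rule order_tendstoD(2)) simp
  ultimately have "\<forall>\<^sub>F n in sequentially. ennreal (1 - sqrt (e n)) \<le> R n"
    using ev_n ev_d ev_s assms(5,6,8,9)
  proof eventually_elim
    case (elim n)
    have m: "s n \<le> 2 * m n" "2 * m n \<le> s n + 1" by (auto simp: m_def)
    have "2 * real (s n) < sqrt (real (d n))"
      using elim by (simp add: field_simps)
    then have "(2 * real (s n))\<^sup>2 \<le> real (d n)"
      by (intro sqrt_ge_absD) auto
    moreover have "2 * real (s n) * 1 \<le> (2 * real (s n)) * (2 * real (s n))"
      using elim by (intro mult_left_mono) auto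
    ultimately have "2 * s n \<le> d n"
      by (simp add: power2_eq_square)
    then have md: "2 * m n \<le> d n" using m elim by linarith
    have n1: "2 * real n \<le> real (s n) * ln (real (d n) / (real (s n))\<^sup>2)"
    proof -
      have "2 \<le> real (s n) * ln (real (d n) / (real (s n))\<^sup>2) / real n"
        using elim \<open>0 < \<epsilon>\<close> by linarith
      then show ?thesis using elim by (simp add: field_simps)
    qed
    have "0 < ln (sqrt (2 * real (s n)))"
      using elim by (intro ln_gt_zero) auto
    then have n2: "(1 + \<epsilon>) * (real n * ln (sqrt (2 * real (s n))))
        \<le> real (s n) * ln (real (d n) / (2 * real (s n)))"
      using elim by (subst pos_le_divide_eq[symmetric]) auto
    have "overlap_moment n (d n) (m n) - 1 \<le> e n"
      unfolding e_def using elim m \<open>0 < \<epsilon>\<close>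
      by (intro overlap_moment_le[OF _ _ _ _ _ n1 n2 \<rho>1_def _ \<rho>2_def]) auto
    then have "ennreal (1 - sqrt (e n)) \<le> ennreal (1 - sqrt (overlap_moment n (d n) (m n) - 1))"
      by (intro ennreal_leI) simp
    also have "\<dots> \<le> R n"
      unfolding R_def using elim m md
      by (intro INF_greatest minimax_risk_ge assms(3,4)) auto
    finally show ?case .
  qed
  moreover have "R n \<le> 1" for n
    unfolding R_def by (rule INF_lower2[of 0]) (auto intro: minimax_risk_le_1)
  ultimately have "R \<longlonglongrightarrow> 1"
    by (intro tendsto_sandwich[OF _ _ lower_lim tendsto_const]) auto
  then show ?thesis
    unfolding R_def by (intro lim_imp_Liminf) auto
qed

end
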